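(* Let $q\in(0,1)$, $\alpha>0$, $d\in\mathbb{N}$, $d\ge1$. Let $\omega$ be a random permutation of $\mathbb{Z}$ distributed according to the Mallows product measure $\mathcal{M}^p_\alpha$, and let $s_1<s_2<\cdots<s_d$ be the elements of the random set $\{s\in\mathbb{Z}:\omega(s)\in\{1,2,\ldots,d\}\}$ in increasing order (the positions of the $d$ second class particles). Then for arbitrary integers $x_1<x_2<\cdots<x_d$, $$\mathbb{P}(s_1=x_1,s_2=x_2,\ldots,s_d=x_d)=\frac{\alpha^d\, q^{\sum_{i=1}^d x_i-\frac{d(2d+1)}{2}}\prod_{i=1}^d(1-q^i)}{\prod_{j=1}^d\left(1+\alpha q^{x_j+j-d-\frac32}\right)\left(1+\alpha q^{x_j+j-d-\frac12}\right)}.$$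
   Context: Fix $q\in(0,1)$. Let $\mathfrak{S}$ be the set of all bijections $\omega:\mathbb{Z}\to\mathbb{Z}$ with the $\sigma$-algebra generated by the coordinate maps $\omega\mapsto\omega(i)$. A probability measure $\mathbb{P}$ on $\mathfrak{S}$ is $q$-exchangeable if for every $i\in\mathbb{Z}$, every finite $I\subset\mathbb{Z}$ containing $i,i+1$, and all distinct integers $(y_j)_{j\in I}$: with $y'$ obtained from $y$ by swapping $y_i$ and $y_{i+1}$, one has $\mathbb{P}(\omega(j)=y'_j\ \forall j\in I)=q^{\mathrm{sign}(y_{i+1}-y_i)}\,\mathbb{P}(\omega(j)=y_j\ \forall j\in I)$. A permutation $\sigma\in\mathfrak{S}$ is balanced if $\#\{j>0:\sigma(j)\le 0\}=\#\{j\le 0:\sigma(j)>0\}<\infty$. By a theorem of Gnedin and Olshanski there is a unique $q$-exchangeable probability measure on $\mathfrak{S}$ supported on balanced permutations; it is denoted $\mathcal{M}_0$, and it is invariant under $\sigma\mapsto\sigma^{-1}$. For $c\in\mathbb{Z}$, $\mathcal{M}_c$ is the law of the permutation $i\mapsto\sigma(i)-c$, where $\sigma\sim\mathcal{M}_0$. With $(q;q)_\infty=\prod_{k\ge1}(1-q^k)$, the Mallows product measure with parameter $\alpha>0$ is $$\mathcal{M}^p_\alpha=\sum_{c\in\mathbb{Z}}\frac{\alpha^c q^{c^2/2}}{(q;q)_\infty\prod_{k=0}^\infty(1+\alpha q^{k+1/2})\prod_{k=0}^\infty(1+\alpha^{-1}q^{k+1/2})}\,\mathcal{M}_c$$ (the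 coefficients sum to $1$ by the Jacobi triple product identity). *)

theory Defs
  imports "HOL-Probability.Probability"
begin

definition permutations_Z :: "(int \<Rightarrow> int) measure" where
  "permutations_Z = sigma {\<omega>. bij \<omega>} {{\<omega>. bij \<omega> \<and> \<omega> i \<in> A} | i A. True}"

(* Here y is a total function of which only the values on I matter; distinctness is required on I
   only, and "y (i + 1) - y i" is nonzero, so that the exponent is 1 or -1. *)
definition q_exchangeable :: "real \<Rightarrow> (int \<Rightarrow> int) measure \<Rightarrow> bool" where
  "q_exchangeable q M \<longleftrightarrow>
     (\<forall>i I y. finite I \<longrightarrow> i \<in> I \<longrightarrow> i + 1 \<in> I \<longrightarrow> inj_on y I \<longrightarrow>
        measure M {\<omega> \<in> space M. \<forall>j\<in>I. \<omega> j = (y(i := y (i + 1), i + 1 := y i)) j} =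
        q powi sgn (y (i + 1) - y i) * measure M {\<omega> \<in> space M. \<forall>j\<in>I. \<omega> j = y j})"

definition balanced :: "(int \<Rightarrow> int) \<Rightarrow> bool" where
  "balanced \<sigma> \<longleftrightarrow>
     finite {j. 0 < j \<and> \<sigma> j \<le> 0} \<and> finite {j. j \<le> 0 \<and> 0 < \<sigma> j} \<and>
     card {j. 0 < j \<and> \<sigma> j \<le> 0} = card {j. j \<le> 0 \<and> 0 < \<sigma> j}"

(* By the theorem of Gnedin and Olshanski exactly one measure satisfies this predicate for each q in (0,1);
   it is the Mallows measure M_0. *)
definition is_mallows_measure :: "real \<Rightarrow> (int \<Rightarrow> int) measure \<Rightarrow> bool" where
  "is_mallows_measure q M \<longleftrightarrow>
     prob_space M \<and> sets M = sets permutations_Z \<and> q_exchangeable q M \<and> (AE \<sigma> in M. balanced \<sigma>)"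

definition shifted_measure :: "(int \<Rightarrow> int) measure \<Rightarrow> int \<Rightarrow> (int \<Rightarrow> int) measure" where
  "shifted_measure M c = distr M permutations_Z (\<lambda>\<sigma> i. \<sigma> i - c)"

definition mallows_weight :: "real \<Rightarrow> real \<Rightarrow> int \<Rightarrow> real" where
  "mallows_weight q \<alpha> c =
     \<alpha> powi c * q powr ((real_of_int c)\<^sup>2 / 2) /
     ((\<Prod>k. 1 - q ^ (k + 1)) *
      (\<Prod>k. 1 + \<alpha> * q powr (real k + 1 / 2)) *
      (\<Prod>k. 1 + inverse \<alpha> * q powr (real k + 1 / 2)))"

(* The mixture over all c; the sum over the integers is the integral against counting measure. *)
definition mallows_product_measure ::
    "real \<Rightarrow> real \<Rightarrow> (int \<Rightarrow> int) measure \<Rightarrow> (int \<Rightarrow> int) measure" where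
  "mallows_product_measure q \<alpha> M\<^sub>0 =
     measure_of (space permutations_Z) (sets permutations_Z)
       (\<lambda>A. \<integral>\<^sup>+c. ennreal (mallows_weight q \<alpha> c) * emeasure (shifted_measure M\<^sub>0 c) A \<partial>count_space UNIV)"

(* measure_of silently yields the zero measure if its argument is not countably additive;
   this does not happen here. *)
lemma emeasure_mallows_product_measure:
  assumes "A \<in> sets permutations_Z"
  shows "emeasure (mallows_product_measure q \<alpha> M\<^sub>0) A =
    (\<integral>\<^sup>+c. ennreal (mallows_weight q \<alpha> c) * emeasure (shifted_measure M\<^sub>0 c) A \<partial>count_space UNIV)"
proof -
  have s: "sets (shifted_measure M\<^sub>0 c) = sets permutations_Z" for c
    by (simp add: shifted_measure_def)
  show ?thesis
    unfolding mallows_product_measure_def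
  proof (rule emeasure_measure_of_sigma[OF sets.sigma_algebra_axioms _ _ assms])
    show "positive (sets permutations_Z) (\<lambda>A. \<integral>\<^sup>+c. ennreal (mallows_weight q \<alpha> c) *
        emeasure (shifted_measure M\<^sub>0 c) A \<partial>count_space UNIV)"
      by (simp add: positive_def)
    show "countably_additive (sets permutations_Z) (\<lambda>A. \<integral>\<^sup>+c. ennreal (mallows_weight q \<alpha> c) *
        emeasure (shifted_measure M\<^sub>0 c) A \<partial>count_space UNIV)"
      unfolding countably_additive_def
    proof (intro allI impI)
      fix B :: "nat \<Rightarrow> (int \<Rightarrow> int) set"
      assume B: "range B \<subseteq> sets permutations_Z" "disjoint_family B"
      then have "(\<Sum>n. emeasure (shifted_measure M\<^sub>0 c) (B n)) = emeasure (shifted_measure M\<^sub>0 c) (\<Union> (range B))" for c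
        by (intro suminf_emeasure) (auto simp: s)
      then show "(\<Sum>n. \<integral>\<^sup>+c. ennreal (mallows_weight q \<alpha> c) * emeasure (shifted_measure M\<^sub>0 c) (B n) \<partial>count_space UNIV) =
          (\<integral>\<^sup>+c. ennreal (mallows_weight q \<alpha> c) * emeasure (shifted_measure M\<^sub>0 c) (\<Union> (range B)) \<partial>count_space UNIV)"
        by (subst nn_integral_suminf[symmetric]) (auto simp: ennreal_suminf_cmult)
    qed
  qed
qed

(* The i-th smallest s, for i = 1, ..., d, with \<omega> s in {1, ..., d}. *)
definition second_class_position :: "nat \<Rightarrow> (int \<Rightarrow> int) \<Rightarrow> nat \<Rightarrow> int" where
  "second_class_position d \<omega> i = sorted_list_of_set {s. \<omega> s \<in> {1..int d}} ! (i - 1)"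

end

theory Submission
  imports Defs
begin

text \<open>
  Call a site \<open>s\<close> first class if \<open>\<omega> s \<le> 0\<close>, second class if \<open>1 \<le> \<omega> s \<le> d\<close>, and a hole otherwise; let
  \<open>A\<close> and \<open>X\<close> be the sets of first and of second class sites.  Almost surely \<open>A\<close> differs from
  \<open>{..0}\<close> in finitely many sites, so only countably many pairs \<open>(A, X)\<close> occur, and the theorem
  follows from an explicit formula for the probability of each pair: it is proportional to
  \<open>\<alpha>^charge(A) * q^energy(A, X)\<close> (lemma \<open>product_measure_gibbs\<close>).  Here \<open>charge A\<close> is the number of
  first class sites in \<open>{1..}\<close> minus the number of other sites in \<open>{..0}\<close>, and the energy is
  \<open>(\<Sum>a\<in>A, a > 0. a - 1/2) + (\<Sum>b\<notin>A, b \<le> 0. 1/2 - b) + (\<Sum>x\<in>X. #{b < x. b \<notin> A \<union> X})\<close>.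

  The formula has two sources.  Interchanging two neighbours of different classes
  changes the energy by one and, by q-exchangeability, the probability by a factor \<open>q\<close>
  (\<open>class_event_swap\<close>).  As sorting brings each configuration of charge \<open>c\<close> to the same
  ground state, its law under the shifted measure with parameter \<open>c\<close> is \<open>k c * q^energy\<close> for
  some constant \<open>k c\<close> (\<open>class_event_gibbs\<close>).  Translating all particles by one site maps charge \<open>c\<close>
  to charge \<open>c + 1\<close> and raises the energy by \<open>c + 1/2\<close>; as probabilities sum to one,
  \<open>k (c + 1) * q^(c + 1/2) = k c\<close> (\<open>gibbs_constant_step\<close>).  The mixture weight
  \<open>\<alpha>^c * q^(c^2/2)\<close> gains the factor \<open>\<alpha> * q^(c + 1/2)\<close>, so the constants of different charges
  differ by powers of \<open>\<alpha>\<close> alone.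

  In this law, turning the hole \<open>s\<close> into a first class particle multiplies the weight by
  \<open>\<alpha> * q^(s - 1/2 - #{x \<in> X. x > s})\<close>, a factor in which \<open>A\<close> does not appear.  Comparing the four
  ways to place a second class particle and either kind of neighbour on two adjacent sites
  therefore gives the ratio of the probabilities of \<open>X\<close> and of the set where that
  particle has jumped one site to the right (\<open>second_class_event_step\<close>).  With
  \<open>g y = 1 / (1 + \<alpha> * q^(y - 1/2))\<close> these ratios say that the positions \<open>x\<close> have probability
  \<open>C * (\<Prod>j=1..d. g y\<^sub>j - g (y\<^sub>j - 1))\<close> with \<open>y\<^sub>j = x\<^sub>j + j - d\<close> (\<open>product_form\<close>).  Summing over the positions
  from the leftmost to the rightmost one, every sum telescopes (\<open>tail_law\<close>), and the total mass one
  determines \<open>C\<close>.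
\<close>

section \<open>Adjacent swaps and q-exchangeable measures\<close>

abbreviation adj_swap :: "int \<Rightarrow> int \<Rightarrow> int" where
  "adj_swap i \<equiv> Transposition.transpose i (i + 1)"

definition cylinder :: "int set \<Rightarrow> (int \<Rightarrow> int) \<Rightarrow> (int \<Rightarrow> int) set" where
  "cylinder I y = {\<omega>. bij \<omega> \<and> (\<forall>j\<in>I. \<omega> j = y j)}"

lemma space_permutations_Z [simp]: "space permutations_Z = {\<omega>. bij \<omega>}"
  unfolding permutations_Z_def by (subst space_measure_of) auto

lemma sets_permutations_Z:
  "sets permutations_Z = sigma_sets {\<omega>. bij \<omega>} {{\<omega>. bij \<omega> \<and> \<omega> i \<in> A} | i A. True}"
  unfolding permutations_Z_def by (subst sets_measure_of) auto

lemma measurable_coordinate [measurable]: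
  "(\<lambda>\<omega>. \<omega> i) \<in> measurable permutations_Z (count_space UNIV)"
proof (rule measurableI)
  fix A :: "int set"
  have "(\<lambda>\<omega>. \<omega> i) -` A \<inter> space permutations_Z = {\<omega>. bij \<omega> \<and> \<omega> i \<in> A}" by auto
  then show "(\<lambda>\<omega>. \<omega> i) -` A \<inter> space permutations_Z \<in> sets permutations_Z"
    unfolding sets_permutations_Z by (auto intro: sigma_sets.Basic)
qed simp

lemma measurable_to_permutations_Z:
  assumes "\<And>x. x \<in> space N \<Longrightarrow> bij (f x)"
    and "\<And>i. (\<lambda>x. f x i) \<in> measurable N (count_space UNIV)"
  shows "f \<in> measurable N permutations_Z"
  unfolding permutations_Z_def
proof (rule measurable_measure_of)
  fix B :: "(int \<Rightarrow> int) set" assume "B \<in> {{\<omega>. bij \<omega> \<and> \<omega> i \<in> A} | i A. True}"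
  then obtain i A where B: "B = {\<omega>. bij \<omega> \<and> \<omega> i \<in> A}" by auto
  have "f -` B \<inter> space N = (\<lambda>x. f x i) -` A \<inter> space N"
    using assms(1) B by auto
  also have "\<dots> \<in> sets N"
    using assms(2)[of i] by (rule measurable_sets) simp
  finally show "f -` B \<inter> space N \<in> sets N" .
qed (use assms(1) in auto)

lemma measurable_compose_permutation:
  assumes "bij g"
  shows "(\<lambda>\<sigma>. \<sigma> \<circ> g) \<in> measurable permutations_Z permutations_Z"
proof (rule measurable_to_permutations_Z)
  show "bij (\<sigma> \<circ> g)" if "\<sigma> \<in> space permutations_Z" for \<sigma>
    using that assms by (auto intro: bij_comp)
  show "(\<lambda>\<sigma>. (\<sigma> \<circ> g) i) \<in> measurable permutations_Z (count_space UNIV)" for i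
    unfolding comp_def by measurable
qed

lemma cylinder_sets: "finite I \<Longrightarrow> cylinder I y \<in> sets permutations_Z"
proof -
  assume I: "finite I"
  have "cylinder I y = {\<omega> \<in> space permutations_Z. \<forall>j\<in>I. \<omega> j = y j}"
    by (auto simp: cylinder_def)
  also have "\<dots> \<in> sets permutations_Z" using I by measurable
  finally show ?thesis .
qed

text \<open>
  Enlarging the index set splits a cylinder into countably many cylinders; hence those whose index
  set contains a prescribed finite set \<open>J\<close> still generate the \<open>\<sigma>\<close>-algebra.  With \<open>J = {i, i + 1}\<close> they
  are the events to which q-exchangeability at \<open>i\<close> applies.
\<close>
lemma sets_permutations_Z_cylinders:
  "sets permutations_Z = sigma_sets {\<omega>. bij \<omega>} {cylinder I y | I y. finite I \<and> J \<subseteq> I}"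
  (is "_ = sigma_sets ?S ?G") if J: "finite J" for J
proof
  have "sigma_algebra ?S (sigma_sets ?S ?G)"
    by (rule sigma_algebra_sigma_sets) (auto simp: cylinder_def)
  then interpret G: sigma_algebra ?S "sigma_sets ?S ?G" .
  show "sets permutations_Z \<subseteq> sigma_sets ?S ?G"
    unfolding sets_permutations_Z
  proof (rule sigma_sets_mono, safe)
    fix i :: int and A :: "int set"
    \<comment> \<open>Value lists along \<open>l\<close> index the cylinders on \<open>insert i J\<close> by a countable type.\<close>
    obtain l where l: "set l = insert i J" using J finite_list by blast
    let ?y = "\<lambda>f j. the (map_of (zip l f) j)"
    have "{\<omega>. bij \<omega> \<and> \<omega> i \<in> A} = (\<Union>f\<in>{f. ?y f i \<in> A}. cylinder (insert i J) (?y f))"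
    proof (safe, goal_cases)
      case (1 \<omega>)
      have "map_of (zip l (map \<omega> l)) j = Some (\<omega> j)" if "j \<in> insert i J" for j
        using that l by (simp add: map_of_zip_map)
      then show ?case using 1
        by (intro UN_I[of "map \<omega> l"]) (auto simp: cylinder_def)
    qed (auto simp: cylinder_def)
    also have "\<dots> \<in> sigma_sets ?S ?G"
      using J by (intro G.countable_UN'') (auto intro!: sigma_sets.Basic)
    finally show "{\<omega>. bij \<omega> \<and> \<omega> i \<in> A} \<in> sigma_sets ?S ?G" .
  qed
  show "sigma_sets ?S ?G \<subseteq> sets permutations_Z"
    using sets.sigma_sets_subset[of ?G permutations_Z] cylinder_sets by auto
qed

text \<open>
  The defining relation of q-exchangeability concerns finitely many coordinates, while the
  configuration of classes depends on all of them.  Both sides below are finite measures in \<open>B\<close>, and on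
  cylinders whose index set contains \<open>i\<close> and \<open>i + 1\<close> their equality is the defining relation; these cylinders
  are closed under intersection, so the measures agree.
\<close>
lemma q_exchangeable_swap:
  fixes M :: "(int \<Rightarrow> int) measure"
  assumes M: "finite_measure M" "sets M = sets permutations_Z" "q_exchangeable q M"
    and q: "0 < q" and B: "B \<in> sets permutations_Z"
  shows "emeasure M {\<sigma>\<in>space M. \<sigma> \<circ> adj_swap i \<in> B \<and> \<sigma> (i + 1) < \<sigma> i} =
    ennreal q * emeasure M {\<sigma>\<in>space M. \<sigma> \<in> B \<and> \<sigma> i < \<sigma> (i + 1)}"
proof -
  interpret finite_measure M by fact
  let ?t = "adj_swap i"
  let ?G = "{cylinder I y | I y. finite I \<and> {i, i + 1} \<subseteq> I}"
  have sp: "space M = {\<omega>. bij \<omega>}" using sets_eq_imp_space_eq[OF M(2)] by simp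
  have Mc: "(\<lambda>\<omega>. \<omega> j) \<in> measurable M (count_space UNIV)" for j
    using measurable_coordinate by (simp add: measurable_cong_sets[OF M(2) refl])
  have Mt: "(\<lambda>\<sigma>. \<sigma> \<circ> ?t) \<in> measurable M permutations_Z"
    using measurable_compose_permutation[of ?t] by (simp add: measurable_cong_sets[OF M(2) refl])
  have desc: "{\<sigma>\<in>space M. \<sigma> (i + 1) < \<sigma> i} \<in> sets M"
    and asc: "{\<sigma>\<in>space M. \<sigma> i < \<sigma> (i + 1)} \<in> sets M"
    using Mc by measurable
  define N1 where "N1 = distr (restrict_space M {\<sigma>\<in>space M. \<sigma> (i + 1) < \<sigma> i}) permutations_Z (\<lambda>\<sigma>. \<sigma> \<circ> ?t)"
  define N2 where "N2 = density M (\<lambda>\<sigma>. ennreal q * indicator {\<sigma>\<in>space M. \<sigma> i < \<sigma> (i + 1)} \<sigma>)"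
  have N1: "emeasure N1 C = emeasure M {\<sigma>\<in>space M. \<sigma> \<circ> ?t \<in> C \<and> \<sigma> (i + 1) < \<sigma> i}"
    if "C \<in> sets permutations_Z" for C
  proof -
    have "emeasure N1 C = emeasure (restrict_space M {\<sigma>\<in>space M. \<sigma> (i + 1) < \<sigma> i})
      ((\<lambda>\<sigma>. \<sigma> \<circ> ?t) -` C \<inter> {\<sigma>\<in>space M. \<sigma> (i + 1) < \<sigma> i})"
      unfolding N1_def using that Mt
      by (subst emeasure_distr) (auto intro!: measurable_restrict_space1 simp: space_restrict_space Int_def intro: arg_cong2[where f=emeasure])
    also have "\<dots> = emeasure M ((\<lambda>\<sigma>. \<sigma> \<circ> ?t) -` C \<inter> {\<sigma>\<in>space M. \<sigma> (i + 1) < \<sigma> i})"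
      using desc by (intro emeasure_restrict_space) auto
    also have "(\<lambda>\<sigma>. \<sigma> \<circ> ?t) -` C \<inter> {\<sigma>\<in>space M. \<sigma> (i + 1) < \<sigma> i} =
      {\<sigma>\<in>space M. \<sigma> \<circ> ?t \<in> C \<and> \<sigma> (i + 1) < \<sigma> i}" by auto
    finally show ?thesis .
  qed
  have N2: "emeasure N2 C = ennreal q * emeasure M {\<sigma>\<in>space M. \<sigma> \<in> C \<and> \<sigma> i < \<sigma> (i + 1)}"
    if C: "C \<in> sets permutations_Z" for C
  proof -
    have "emeasure N2 C = (\<integral>\<^sup>+\<sigma>. ennreal q * indicator {\<sigma>\<in>space M. \<sigma> i < \<sigma> (i + 1)} \<sigma> * indicator C \<sigma> \<partial>M)"
      unfolding N2_def using that M(2) asc by (subst emeasure_density) auto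
    also have "\<dots> = (\<integral>\<^sup>+\<sigma>. ennreal q * indicator ({\<sigma>\<in>space M. \<sigma> i < \<sigma> (i + 1)} \<inter> C) \<sigma> \<partial>M)"
      by (intro nn_integral_cong) (auto simp: indicator_def)
    also have "\<dots> = ennreal q * emeasure M ({\<sigma>\<in>space M. \<sigma> i < \<sigma> (i + 1)} \<inter> C)"
      using asc C M(2) by (subst nn_integral_cmult_indicator) auto
    also have "{\<sigma>\<in>space M. \<sigma> i < \<sigma> (i + 1)} \<inter> C = {\<sigma>\<in>space M. \<sigma> \<in> C \<and> \<sigma> i < \<sigma> (i + 1)}" by auto
    finally show ?thesis .
  qed
  have gen: "emeasure N1 C = emeasure N2 C" if "C \<in> ?G" for C
  proof -
    from that obtain I y where C: "C = cylinder I y" and "finite I \<and> {i, i + 1} \<subseteq> I"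
      by blast
    then have I: "finite I" "i \<in> I" "i + 1 \<in> I" by auto
    have Cs: "C \<in> sets permutations_Z" using C cylinder_sets I by auto
    have eqv: "(\<forall>j\<in>I. (\<sigma> \<circ> ?t) j = y j) \<longleftrightarrow> (\<forall>j\<in>I. \<sigma> j = (y(i := y (i + 1), i + 1 := y i)) j)" for \<sigma>
    proof -
      have "y(i := y (i + 1), i + 1 := y i) = y \<circ> ?t"
        by (rule ext) (simp add: Transposition.transpose_def)
      moreover have "?t ` I = I" using I by simp
      then have "(\<forall>j\<in>I. \<sigma> j = (y \<circ> ?t) j) \<longleftrightarrow> (\<forall>j\<in>?t ` I. \<sigma> j = (y \<circ> ?t) j)" by (rule ssubst) (rule refl)
      ultimately show ?thesis by (simp add: ball_simps)
    qed
    have bt: "bij (\<sigma> \<circ> ?t) \<longleftrightarrow> bij \<sigma>" for \<sigma> :: "int \<Rightarrow> int"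
      by (meson bij_betw_comp_iff bij_transpose)
    show ?thesis
    proof (cases "inj_on y I \<and> y i < y (i + 1)")
      case True
      have "{\<sigma>\<in>space M. \<sigma> \<circ> ?t \<in> C \<and> \<sigma> (i + 1) < \<sigma> i} =
        {\<sigma>\<in>space M. \<forall>j\<in>I. \<sigma> j = (y(i := y (i + 1), i + 1 := y i)) j}"
      proof -
        have "\<sigma> (i + 1) < \<sigma> i" if "\<forall>j\<in>I. \<sigma> j = (y(i := y (i + 1), i + 1 := y i)) j" for \<sigma>
          using bspec[OF that I(2)] bspec[OF that I(3)] True by simp
        then show ?thesis unfolding C cylinder_def mem_Collect_eq eqv bt sp by blast
      qed
      moreover have "{\<sigma>\<in>space M. \<sigma> \<in> C \<and> \<sigma> i < \<sigma> (i + 1)} = {\<sigma>\<in>space M. \<forall>j\<in>I. \<sigma> j = y j}"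
      proof -
        have "\<sigma> i < \<sigma> (i + 1)" if "\<forall>j\<in>I. \<sigma> j = y j" for \<sigma>
          using bspec[OF that I(2)] bspec[OF that I(3)] True by simp
        then show ?thesis unfolding C cylinder_def mem_Collect_eq sp by blast
      qed
      moreover have "measure M {\<sigma>\<in>space M. \<forall>j\<in>I. \<sigma> j = (y(i := y (i + 1), i + 1 := y i)) j} =
        q * measure M {\<sigma>\<in>space M. \<forall>j\<in>I. \<sigma> j = y j}"
      proof -
        have "sgn (y (i + 1) - y i) = 1" using True by simp
        then show ?thesis
          using M(3)[unfolded q_exchangeable_def, rule_format, of I i y] I True by simp
      qed
      ultimately show ?thesis
        using q by (simp add: N1[OF Cs] N2[OF Cs] emeasure_eq_measure ennreal_mult)
    next
      case False
      have e1: "{\<sigma>\<in>space M. \<sigma> \<circ> ?t \<in> C \<and> \<sigma> (i + 1) < \<sigma> i} = {}"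
      proof (safe, simp)
        fix \<sigma> assume s: "\<sigma> \<in> space M" "\<sigma> \<circ> ?t \<in> C" "\<sigma> (i + 1) < \<sigma> i"
        then have "\<forall>j\<in>I. (\<sigma> \<circ> ?t) j = y j" "bij (\<sigma> \<circ> ?t)" by (auto simp: C cylinder_def)
        then have y: "y j = \<sigma> (?t j)" if "j \<in> I" for j using that by simp
        have "inj \<sigma>" using s sp by (simp add: bij_is_inj)
        then have "inj_on y I" by (intro inj_onI) (simp add: y inj_eq)
        moreover have "y i < y (i + 1)" using s(3) y[OF I(2)] y[OF I(3)] by simp
        ultimately show False using False by blast
      qed
      have e2: "{\<sigma>\<in>space M. \<sigma> \<in> C \<and> \<sigma> i < \<sigma> (i + 1)} = {}"
      proof (safe, simp)
        fix \<sigma> assume s: "\<sigma> \<in> space M" "\<sigma> \<in> C" "\<sigma> i < \<sigma> (i + 1)"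
        then have y: "y j = \<sigma> j" if "j \<in> I" for j using that by (simp add: C cylinder_def)
        have "inj \<sigma>" using s sp by (simp add: bij_is_inj)
        then have "inj_on y I" by (intro inj_onI) (simp add: y inj_eq)
        moreover have "y i < y (i + 1)" using s(3) y[OF I(2)] y[OF I(3)] by simp
        ultimately show False using False by blast
      qed
      show ?thesis by (simp add: N1[OF Cs] N2[OF Cs] e1 e2)
    qed
  qed
  have "N1 = N2"
  proof (rule measure_eqI_generator_eq_countable[of ?G "{\<omega>. bij \<omega>}" N1 N2
        "range (\<lambda>(a, b). cylinder {i, i + 1} ((\<lambda>_. a)(i + 1 := b)))"])
    show "Int_stable ?G"
    proof (rule Int_stableI, safe)
      fix I y J z assume I: "finite I" "{i, i + 1} \<subseteq> I" and J: "finite J" "{i, i + 1} \<subseteq> J"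
      show "\<exists>K w. cylinder I y \<inter> cylinder J z = cylinder K w \<and> finite K \<and> {i, i + 1} \<subseteq> K"
      proof (cases "\<forall>j\<in>I\<inter>J. y j = z j")
        case True
        then have "cylinder I y \<inter> cylinder J z = cylinder (I \<union> J) (\<lambda>j. if j \<in> I then y j else z j)"
          by (auto simp: cylinder_def split: if_splits)
        then show ?thesis using I J by blast
      next
        case False
        \<comment> \<open>Prescribing equal values at two sites gives an empty cylinder.\<close>
        have "cylinder {i, i + 1} (\<lambda>_. 0) = {}"
          by (auto simp: cylinder_def bij_def inj_def) (metis add_cancel_right_right zero_neq_one)
        moreover have "cylinder I y \<inter> cylinder J z = {}"
          using False by (auto simp: cylinder_def)
        ultimately show ?thesis by (metis finite.emptyI finite.insertI order_refl)
      qed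
    qed
    show "emeasure N1 X = emeasure N2 X" if "X \<in> ?G" for X using gen that .
    show "?G \<subseteq> Pow {\<omega>. bij \<omega>}" by (auto simp: cylinder_def)
    show "sets N1 = sigma_sets {\<omega>. bij \<omega>} ?G" "sets N2 = sigma_sets {\<omega>. bij \<omega>} ?G"
      using sets_permutations_Z_cylinders[of "{i, i + 1}"] M(2) by (simp_all add: N1_def N2_def)
    show "range (\<lambda>(a, b). cylinder {i, i + 1} ((\<lambda>_. a)(i + 1 := b))) \<subseteq> ?G" by force
    show "\<Union> (range (\<lambda>(a, b). cylinder {i, i + 1} ((\<lambda>_. a)(i + 1 := b)))) = {\<omega>. bij \<omega>}"
      by (force simp: cylinder_def)
    show "countable (range (\<lambda>(a, b). cylinder {i, i + 1} ((\<lambda>_. a)(i + 1 := b))))" by simp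
    fix C assume "C \<in> range (\<lambda>(a, b). cylinder {i, i + 1} ((\<lambda>_. a)(i + 1 := b)))"
    then have "C \<in> sets permutations_Z" by (auto intro: cylinder_sets)
    then show "emeasure N1 C \<noteq> \<infinity>" by (simp add: N1)
  qed
  then show ?thesis using N1[OF B] N2[OF B] by simp
qed

section \<open>Energy of a sea with second class particles\<close>

text \<open>
  A Dirac sea: finitely many particles lie above the surface, and finitely many sites are
  empty below it.
\<close>
definition sea :: "int set \<Rightarrow> bool" where
  "sea A \<longleftrightarrow> finite (A \<inter> {0<..}) \<and> finite ({..0} - A)"

definition charge :: "int set \<Rightarrow> int" where
  "charge A = int (card (A \<inter> {0<..})) - int (card ({..0} - A))"

text \<open>
  The energy of the corresponding free fermion state, measured from the full sea \<open>{..0}\<close>: each particle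
  contributes its height \<open>a - 1/2\<close>, each missing particle the depth \<open>1/2 - b\<close>.
\<close>
definition sea_energy :: "int set \<Rightarrow> real" where
  "sea_energy A = (\<Sum>a\<in>A \<inter> {0<..}. real_of_int a - 1 / 2) + (\<Sum>b\<in>{..0} - A. 1 / 2 - real_of_int b)"

lemma sea_insert [simp]: "sea (insert s A) \<longleftrightarrow> sea A"
proof (cases "0 < s")
  case True
  then have "insert s A \<inter> {0<..} = insert s (A \<inter> {0<..})" "{..0} - insert s A = {..0} - A" by auto
  then show ?thesis by (simp add: sea_def)
next
  case False
  then have "insert s A \<inter> {0<..} = A \<inter> {0<..}" "{..0} - insert s A = ({..0} - A) - {s}" by auto
  then show ?thesis by (simp add: sea_def)
qed

lemma charge_insert:
  assumes "sea A" "s \<notin> A"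
  shows "charge (insert s A) = charge A + 1"
proof (cases "0 < s")
  case True
  then have e: "insert s A \<inter> {0<..} = insert s (A \<inter> {0<..})" "{..0} - insert s A = {..0} - A" by auto
  show ?thesis using assms unfolding charge_def e by (simp add: sea_def)
next
  case False
  define N where "N = {..0} - insert s A"
  have e: "insert s A \<inter> {0<..} = A \<inter> {0<..}" "{..0} - A = insert s N" "{..0} - insert s A = N"
    using False assms by (auto simp: N_def)
  have "finite N" "s \<notin> N" using assms by (auto simp: N_def sea_def)
  then show ?thesis unfolding charge_def e by simp
qed

lemma sea_energy_insert:
  assumes "sea A" "s \<notin> A"
  shows "sea_energy (insert s A) = sea_energy A + (real_of_int s - 1 / 2)"
proof (cases "0 < s")
  case True
  then have e: "insert s A \<inter> {0<..} = insert s (A \<inter> {0<..})" "{..0} - insert s A = {..0} - A" by auto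
  show ?thesis using assms unfolding sea_energy_def e by (simp add: sea_def)
next
  case False
  define N where "N = {..0} - insert s A"
  have e: "insert s A \<inter> {0<..} = A \<inter> {0<..}" "{..0} - A = insert s N" "{..0} - insert s A = N"
    using False assms by (auto simp: N_def)
  have "finite N" "s \<notin> N" using assms by (auto simp: N_def sea_def)
  then show ?thesis unfolding sea_energy_def e by simp
qed

lemma sea_energy_nonneg: "0 \<le> sea_energy A"
  unfolding sea_energy_def by (intro add_nonneg_nonneg sum_nonneg) auto

lemma sea_union_finite: "finite X \<Longrightarrow> sea (A \<union> X) \<longleftrightarrow> sea A"
  by (induction X rule: finite_induct) auto

lemma charge_union_finite:
  assumes "sea A" "finite X" "A \<inter> X = {}"
  shows "charge (A \<union> X) = charge A + int (card X)"
  using assms(2,3)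
proof (induction X rule: finite_induct)
  case (insert s X)
  then show ?case
    using charge_insert[of "A \<union> X" s] assms(1) by (auto simp: sea_union_finite)
qed simp

lemma sea_remove: "s \<in> A \<Longrightarrow> sea (A - {s}) \<longleftrightarrow> sea A"
  by (metis insert_Diff sea_insert)

lemma charge_move:
  assumes "sea A" "s \<in> A" "t \<notin> A"
  shows "charge (insert t (A - {s})) = charge A"
  using assms charge_insert[of "A - {s}" t] charge_insert[of "A - {s}" s]
  by (auto simp: sea_remove insert_absorb)

lemma sea_energy_move:
  assumes "sea A" "s \<in> A" "t \<notin> A"
  shows "sea_energy (insert t (A - {s})) = sea_energy A + real_of_int (t - s)"
  using assms sea_energy_insert[of "A - {s}" t] sea_energy_insert[of "A - {s}" s]
  by (auto simp: sea_remove insert_absorb)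

lemma charge_atMost: "charge {..m} = m"
proof -
  have 1: "{..m} \<inter> {0<..} = {0<..m}" "{..0} - {..m} = {m<..0}" by auto
  show ?thesis unfolding charge_def 1 by simp
qed

text \<open>
  In terms of partitions the energy of a sea of charge \<open>c\<close> is \<open>c^2/2\<close> plus the size of a partition
  that does not change under translation; hence the increment \<open>(c + 1)^2/2 - c^2/2 = c + 1/2\<close>.
\<close>
lemma sea_translate:
  assumes "sea A"
  shows "sea ((\<lambda>s. s + 1) ` A)"
    and "charge ((\<lambda>s. s + 1) ` A) = charge A + 1"
    and "sea_energy ((\<lambda>s. s + 1) ` A) = sea_energy A + real_of_int (charge A) + 1 / 2"
proof -
  let ?f = "\<lambda>s::int. s + 1"
  let ?A = "?f ` A"
  define P N where "P = A \<inter> {0<..}" and "N = {..0} - A - {0}"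
  have fin: "finite P" "finite N" "0 \<notin> N" "1 \<notin> ?f ` P" using assms by (auto simp: sea_def P_def N_def)
  have fN: "{..0} - ?A = ?f ` N"
  proof safe
    fix x :: int assume "x \<le> 0" "x \<notin> ?A"
    then show "x \<in> ?f ` N"
      by (intro image_eqI[of _ _ "x - 1"]) (auto simp: image_iff N_def)
  qed (auto simp: N_def)
  have inj: "inj_on ?f S" for S by (auto simp: inj_on_def)
  have sN: "(\<Sum>b\<in>?f ` N. 1 / 2 - real_of_int b) = (\<Sum>b\<in>N. 1 / 2 - real_of_int b) - real (card N)"
    by (subst sum.reindex[OF inj]) (simp add: sum_subtractf algebra_simps sum.distrib sum_negf)
  have sP: "(\<Sum>a\<in>?f ` P. real_of_int a - 1 / 2) = (\<Sum>a\<in>P. real_of_int a - 1 / 2) + real (card P)"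
    by (subst sum.reindex[OF inj]) (simp add: sum_subtractf algebra_simps sum.distrib)
  have c: "card (?f ` N) = card N" "card (?f ` P) = card P" by (auto intro!: card_image inj)
  have "sea ?A \<and> charge ?A = charge A + 1 \<and> sea_energy ?A = sea_energy A + real_of_int (charge A) + 1 / 2"
  proof (cases "0 \<in> A")
    case True
    have fP: "?A \<inter> {0<..} = insert 1 (?f ` P)"
    proof safe
      fix x assume "x \<in> A" "0 < x + 1" "x + 1 \<notin> ?f ` P"
      then have "\<not> 0 < x" by (auto simp: P_def)
      with \<open>0 < x + 1\<close> show "x + 1 = 1" by auto
    qed (use True in \<open>auto simp: image_iff P_def\<close>)
    have N0: "{..0} - A = N" using True by (auto simp: N_def)
    show ?thesis
      using fin unfolding sea_def charge_def sea_energy_def fP fN N0 P_def[symmetric]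
      by (simp add: sP sN c)
  next
    case False
    have fP: "?A \<inter> {0<..} = ?f ` P"
    proof safe
      fix x assume "x \<in> A" "0 < x + 1"
      then have "0 < x" using False by (cases "x = 0") auto
      then show "x + 1 \<in> ?f ` P" using \<open>x \<in> A\<close> by (auto simp: P_def)
    qed (auto simp: P_def)
    have N0: "{..0} - A = insert 0 N" using False by (auto simp: N_def)
    show ?thesis
      using fin unfolding sea_def charge_def sea_energy_def fP fN N0 P_def[symmetric]
      by (simp add: sP sN c)
  qed
  then show "sea ?A" "charge ?A = charge A + 1"
    "sea_energy ?A = sea_energy A + real_of_int (charge A) + 1 / 2" by auto
qed

lemma sea_down_closed:
  assumes A: "sea A" and down: "\<And>i. i + 1 \<in> A \<Longrightarrow> i \<in> A"
  shows "A = {..charge A}"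
proof -
  have "\<not> {..0} \<subseteq> {..0} - A"
    using A infinite_Iic[of "0::int"] by (metis finite_subset sea_def)
  then obtain a where a: "a \<in> A" "a \<le> 0" by auto
  have fin: "finite (A \<inter> {a..})"
    by (rule finite_subset[of _ "{a..0} \<union> (A \<inter> {0<..})"]) (use A in \<open>auto simp: sea_def\<close>)
  define m where "m = Max (A \<inter> {a..})"
  have m: "m \<in> A" "a \<le> m" using Max_in[OF fin] a by (auto simp: m_def)
  have le: "s \<le> m" if "s \<in> A" for s
  proof (cases "a \<le> s")
    case True then show ?thesis using that fin by (auto simp: m_def)
  qed (use m in auto)
  have "s \<in> A" if "s \<le> m" for s
    using that
  proof (induction s rule: int_le_induct)
    case (step i)
    then show ?case using down[of "i - 1"] by auto
  qed (use m in auto)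
  then have "A = {..m}" using le by auto
  then show ?thesis using charge_atMost by metis
qed

text \<open>
  For a site \<open>x\<close> of a second class particle and the set \<open>B\<close> of all particles, this is the number of
  inversions between \<open>x\<close> and holes to its left.
\<close>
definition holes_below :: "int set \<Rightarrow> int \<Rightarrow> nat" where
  "holes_below B x = card {b. b < x \<and> b \<notin> B}"

lemma finite_holes_below: "sea B \<Longrightarrow> finite {b. b < x \<and> b \<notin> B}"
  by (rule finite_subset[of _ "({..0} - B) \<union> {0..x}"]) (auto simp: sea_def)

lemma holes_below_insert:
  assumes "sea B" "s \<notin> B"
  shows "holes_below B x = holes_below (insert s B) x + (if s < x then 1 else 0)"
proof (cases "s < x")
  case True
  then have "{b. b < x \<and> b \<notin> B} = insert s {b. b < x \<and> b \<notin> insert s B}" using assms by auto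
  moreover have "finite {b. b < x \<and> b \<notin> insert s B}" using assms by (intro finite_holes_below) simp
  ultimately show ?thesis using True by (simp add: holes_below_def)
next
  case False
  then have "{b. b < x \<and> b \<notin> B} = {b. b < x \<and> b \<notin> insert s B}" by auto
  then show ?thesis using False by (simp add: holes_below_def)
qed

lemma holes_below_move:
  assumes "sea B" "i \<notin> B" "i + 1 \<in> B" "x \<noteq> i + 1"
  shows "holes_below (insert i (B - {i + 1})) x = holes_below B x"
  using assms holes_below_insert[of "B - {i + 1}" i x] holes_below_insert[of "B - {i + 1}" "i + 1" x]
  by (auto simp: sea_remove insert_absorb split: if_splits)

lemma holes_below_Suc:
  assumes "sea B"
  shows "holes_below B (i + 1) = holes_below B i + (if i \<in> B then 0 else 1)"
proof (cases "i \<in> B")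
  case True
  then have "{b. b < i + 1 \<and> b \<notin> B} = {b. b < i \<and> b \<notin> B}"
    using zless_add1_eq by auto
  then show ?thesis using True by (simp add: holes_below_def)
next
  case False
  then have "{b. b < i + 1 \<and> b \<notin> B} = insert i {b. b < i \<and> b \<notin> B}"
    using zless_add1_eq by auto
  then show ?thesis using False finite_holes_below[OF assms] by (simp add: holes_below_def)
qed

lemma holes_below_translate:
  "holes_below ((\<lambda>s. s + 1) ` B) (x + 1) = holes_below B x"
proof -
  have "{b. b < x + 1 \<and> b \<notin> (\<lambda>s. s + 1) ` B} = (\<lambda>s. s + 1) ` {b. b < x \<and> b \<notin> B}"
  proof safe
    fix b assume "b < x + 1" "b \<notin> (\<lambda>s. s + 1) ` B"
    then show "b \<in> (\<lambda>s. s + 1) ` {b. b < x \<and> b \<notin> B}"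
      by (intro image_eqI[of _ _ "b - 1"]) (auto simp: image_iff)
  qed auto
  then show ?thesis unfolding holes_below_def by (simp add: card_image)
qed

definition config :: "int set \<Rightarrow> int set \<Rightarrow> bool" where
  "config A X \<longleftrightarrow> sea A \<and> finite X \<and> A \<inter> X = {}"

text \<open>
  Up to a constant that depends only on the charge and the number of second class particles, this is the
  number of pairs of sites where the class of higher value stands to the left.
\<close>
definition energy :: "int set \<Rightarrow> int set \<Rightarrow> real" where
  "energy A X = sea_energy A + (\<Sum>x\<in>X. real (holes_below (A \<union> X) x))"

lemma energy_nonneg: "0 \<le> energy A X"
  unfolding energy_def by (intro add_nonneg_nonneg sea_energy_nonneg sum_nonneg) auto

text \<open>
  A hole at \<open>s\<close> is counted once by every second class particle to its right; filling it
  removes these terms and adds the height of \<open>s\<close>.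
\<close>
lemma energy_fill:
  assumes "config A X" "s \<notin> A" "s \<notin> X"
  shows "energy (insert s A) X = energy A X + (real_of_int s - 1 / 2 - real (card {x\<in>X. s < x}))"
proof -
  have s: "sea (A \<union> X)" using assms by (auto simp: config_def sea_union_finite)
  have "(\<Sum>x\<in>X. real (holes_below (A \<union> X) x)) =
    (\<Sum>x\<in>X. real (holes_below (insert s A \<union> X) x)) + real (card {x\<in>X. s < x})"
  proof -
    have "(\<Sum>x\<in>X. real (holes_below (A \<union> X) x)) =
      (\<Sum>x\<in>X. real (holes_below (insert s A \<union> X) x) + (if s < x then 1 else 0))"
      using assms holes_below_insert[OF s, of s] by (intro sum.cong refl) auto
    then show ?thesis
      using assms by (simp add: sum.distrib config_def sum.If_cases Int_def)
  qed
  moreover have "sea_energy (insert s A) = sea_energy A + (real_of_int s - 1 / 2)"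
    using assms by (intro sea_energy_insert) (auto simp: config_def)
  ultimately show ?thesis unfolding energy_def by simp
qed

lemma adj_swap_image:
  "adj_swap i ` S = (if i \<in> S \<and> i + 1 \<notin> S then insert (i + 1) (S - {i})
     else if i \<notin> S \<and> i + 1 \<in> S then insert i (S - {i + 1}) else S)"
  by (auto simp: Transposition.transpose_def image_iff split: if_splits)

lemma config_swap: "config A X \<Longrightarrow> config (adj_swap i ` A) (adj_swap i ` X)"
  by (auto simp: config_def adj_swap_image sea_remove)

text \<open>
  The value at \<open>i\<close> exceeds that at \<open>i + 1\<close> here, so that the swap removes one inversion: the first
  class particle moves down by one unit, while the number of holes below each second class particle is
  kept, also if the particle itself is moved from \<open>i\<close> to \<open>i + 1\<close>.
\<close>
lemma energy_swap_sea:
  assumes "config A X" "i \<notin> A" "i + 1 \<in> A"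
  shows "energy (adj_swap i ` A) (adj_swap i ` X) = energy A X - 1"
proof -
  let ?A = "adj_swap i ` A" and ?X = "adj_swap i ` X"
  have A: "?A = insert i (A - {i + 1})" using assms by (auto simp: adj_swap_image)
  have s: "sea (A \<union> X)" "sea A" "finite X" "i + 1 \<notin> X" using assms by (auto simp: config_def sea_union_finite)
  have e1: "sea_energy ?A = sea_energy A - 1"
    unfolding A using assms s by (subst sea_energy_move) auto
  have "(\<Sum>x\<in>?X. real (holes_below (?A \<union> ?X) x)) = (\<Sum>x\<in>X. real (holes_below (A \<union> X) x))"
  proof (cases "i \<in> X")
    case True
    have X: "?X = insert (i + 1) (X - {i})" using True s by (auto simp: adj_swap_image)
    have U: "?A \<union> ?X = A \<union> X" using True assms unfolding A X by auto
    have "holes_below (A \<union> X) (i + 1) = holes_below (A \<union> X) i"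
      using True s by (subst holes_below_Suc) auto
    then show ?thesis unfolding U using True s by (simp add: X sum.remove)
  next
    case False
    have X: "?X = X" using False s by (auto simp: adj_swap_image)
    have "?A \<union> X = insert i ((A \<union> X) - {i + 1})" unfolding A using s by auto
    then have "holes_below (?A \<union> X) x = holes_below (A \<union> X) x" if "x \<in> X" for x
      using assms s False that holes_below_move[of "A \<union> X" i x] by fastforce
    then show ?thesis unfolding X by simp
  qed
  then show ?thesis using e1 by (simp add: energy_def)
qed

text \<open>
  The sea is unchanged; the particle that moves from \<open>i + 1\<close> to \<open>i\<close> loses the hole at \<open>i\<close>.
\<close>
lemma energy_swap_second_class:
  assumes "config A X" "i \<notin> A" "i \<notin> X" "i + 1 \<in> X"
  shows "energy (adj_swap i ` A) (adj_swap i ` X) = energy A X - 1"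
proof -
  let ?A = "adj_swap i ` A" and ?X = "adj_swap i ` X"
  have s: "sea (A \<union> X)" "sea A" "finite X" "i + 1 \<notin> A" using assms by (auto simp: config_def sea_union_finite)
  have A: "?A = A" using assms s by (auto simp: adj_swap_image)
  have X: "?X = insert i (X - {i + 1})" using assms by (auto simp: adj_swap_image)
  have U: "?A \<union> ?X = insert i ((A \<union> X) - {i + 1})" unfolding A X using s by auto
  have su: "sea (insert i ((A \<union> X) - {i + 1}))"
    using s assms by (simp add: sea_remove)
  have 1: "(\<Sum>x\<in>X - {i + 1}. real (holes_below (?A \<union> ?X) x)) = (\<Sum>x\<in>X - {i + 1}. real (holes_below (A \<union> X) x))"
    unfolding U using assms s by (intro sum.cong refl) (auto simp: holes_below_move)
  have 2: "holes_below (A \<union> X) (i + 1) = holes_below (?A \<union> ?X) i + 1"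
    unfolding U using assms s
    by (subst holes_below_Suc) (auto simp: holes_below_move)
  have "(\<Sum>x\<in>?X. real (holes_below (?A \<union> ?X) x)) =
     real (holes_below (?A \<union> ?X) i) + (\<Sum>x\<in>X - {i + 1}. real (holes_below (?A \<union> ?X) x))"
    using s assms by (subst (1) X) simp
  also have "\<dots> = (\<Sum>x\<in>X. real (holes_below (A \<union> X) x)) - 1"
    using s assms 1 2 by (simp add: sum.remove[of X "i + 1"])
  finally show ?thesis by (simp add: energy_def A)
qed

lemma energy_translate:
  assumes "config A X"
  shows "energy ((\<lambda>s. s + 1) ` A) ((\<lambda>s. s + 1) ` X) = energy A X + real_of_int (charge A) + 1 / 2"
proof -
  have "(\<Sum>x\<in>(\<lambda>s. s + 1) ` X. real (holes_below ((\<lambda>s. s + 1) ` A \<union> (\<lambda>s. s + 1) ` X) x)) =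
    (\<Sum>x\<in>X. real (holes_below (A \<union> X) x))"
    unfolding image_Un[symmetric] by (subst sum.reindex) (auto simp: holes_below_translate inj_on_def)
  then show ?thesis using assms sea_translate(3)[of A] by (simp add: energy_def config_def)
qed

text \<open>
  The hypotheses say that no adjacent swap lowers the energy.
\<close>
lemma config_ground_state:
  assumes "config A X" "\<And>i. i + 1 \<in> A \<Longrightarrow> i \<in> A" "\<And>i. i + 1 \<in> X \<Longrightarrow> i \<in> A \<union> X"
  shows "A = {..charge A} \<and> X = {charge A<..charge A + int (card X)}"
proof -
  have s: "sea A" "finite X" "A \<inter> X = {}" using assms(1) by (auto simp: config_def)
  have A: "A = {..charge A}" using s(1) assms(2) by (rule sea_down_closed)
  have "A \<union> X = {..charge (A \<union> X)}"
    using s assms(2,3) by (intro sea_down_closed) (auto simp: sea_union_finite)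
  also have "charge (A \<union> X) = charge A + int (card X)" using charge_union_finite s by blast
  finally have "X = {..charge A + int (card X)} - A" using s(3) by auto
  also have "\<dots> = {charge A<..charge A + int (card X)}" by (subst (1) A) auto
  finally show ?thesis using A by blast
qed

lemma countable_seas: "countable (Collect sea)"
proof (rule countable_image_inj_on[of "\<lambda>A. (A \<inter> {0<..}, {..0} - A)"])
  show "countable ((\<lambda>A. (A \<inter> {0<..}, {..0} - A)) ` Collect sea)"
    by (rule countable_subset[of _ "Collect finite \<times> Collect finite"])
      (auto simp: sea_def countable_Collect_finite)
  show "inj_on (\<lambda>A. (A \<inter> {0<..}, {..0} - A)) (Collect sea)"
  proof (rule inj_onI)
    fix A B :: "int set"
    assume "(A \<inter> {0<..}, {..0} - A) = (B \<inter> {0<..}, {..0} - B)"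
    then have "A \<inter> {0<..} = B \<inter> {0<..}" "{..0} - A = {..0} - B" by (metis prod.inject)+
    from this[THEN arg_cong, of "\<lambda>S. x \<in> S" for x]
    have "x \<in> A \<longleftrightarrow> x \<in> B" for x
      by (cases "0 < x") (metis Int_iff greaterThan_iff, metis DiffD2 DiffI atMost_iff not_le)
    then show "A = B" by blast
  qed
qed

section \<open>Gibbs law of the classes under the balanced measure\<close>

text \<open>
  The parameter \<open>c\<close> lets the unshifted permutation serve for all the shifted measures: values up
  to \<open>c\<close> are first class, the next \<open>d\<close> values second class.
\<close>
definition class_event :: "int \<Rightarrow> nat \<Rightarrow> int set \<Rightarrow> int set \<Rightarrow> (int \<Rightarrow> int) set" where
  "class_event c d A X = {\<sigma>. bij \<sigma> \<and> {s. \<sigma> s \<le> c} = A \<and> {s. c < \<sigma> s \<and> \<sigma> s \<le> c + int d} = X}"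

lemma preimage_event_sets: "{\<sigma>. bij \<sigma> \<and> {s. P (\<sigma> s)} = A} \<in> sets permutations_Z"
proof -
  have "{\<sigma>. bij \<sigma> \<and> {s. P (\<sigma> s)} = A} =
    (\<Inter>s. (\<lambda>\<sigma>. \<sigma> s) -` {v. P v \<longleftrightarrow> s \<in> A} \<inter> space permutations_Z)" by auto
  also have "\<dots> \<in> sets permutations_Z"
  proof (rule sets.countable_INT')
    have "(\<lambda>\<sigma>. \<sigma> s) -` {v. P v \<longleftrightarrow> s \<in> A} \<inter> space permutations_Z \<in> sets permutations_Z" for s
      by (rule measurable_sets[OF measurable_coordinate]) simp
    then show "range (\<lambda>s. (\<lambda>\<sigma>. \<sigma> s) -` {v. P v \<longleftrightarrow> s \<in> A} \<inter> space permutations_Z) \<subseteq> sets permutations_Z"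
      by blast
  qed simp_all
  finally show ?thesis .
qed

lemma class_event_sets: "class_event c d A X \<in> sets permutations_Z"
proof -
  have "class_event c d A X = {\<sigma>. bij \<sigma> \<and> {s. \<sigma> s \<le> c} = A} \<inter>
    {\<sigma>. bij \<sigma> \<and> {s. c < \<sigma> s \<and> \<sigma> s \<le> c + int d} = X}"
    by (auto simp: class_event_def)
  then show ?thesis using preimage_event_sets[of "\<lambda>v. v \<le> c"] preimage_event_sets[of "\<lambda>v. c < v \<and> v \<le> c + int d"]
    by (simp only: sets.Int)
qed

text \<open>
  Raising the threshold \<open>c\<close> by one adds one site to the set, namely the preimage of the new value.
\<close>
lemma sea_of_balanced:
  assumes "bij \<sigma>" "balanced \<sigma>"
  shows "sea {s. \<sigma> s \<le> c} \<and> charge {s. \<sigma> s \<le> c} = c"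
proof (induction c rule: int_induct[where k = 0])
  case base
  have "{s. \<sigma> s \<le> 0} \<inter> {0<..} = {j. 0 < j \<and> \<sigma> j \<le> 0}"
    "{..0} - {s. \<sigma> s \<le> 0} = {j. j \<le> 0 \<and> 0 < \<sigma> j}" by auto
  then show ?case using assms(2) by (simp add: sea_def charge_def balanced_def)
next
  case (step1 c)
  have "{s. \<sigma> s \<le> c + 1} = insert (inv \<sigma> (c + 1)) {s. \<sigma> s \<le> c}"
  proof (intro equalityI subsetI)
    fix s assume "s \<in> {s. \<sigma> s \<le> c + 1}"
    then have "\<sigma> s \<le> c \<or> \<sigma> s = c + 1" by auto
    then show "s \<in> insert (inv \<sigma> (c + 1)) {s. \<sigma> s \<le> c}"
      using assms(1) by (metis bij_inv_eq_iff insert_iff mem_Collect_eq)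
  qed (use assms(1) in \<open>auto simp: bij_is_surj surj_f_inv_f\<close>)
  moreover have "inv \<sigma> (c + 1) \<notin> {s. \<sigma> s \<le> c}"
    using assms(1) by (simp add: bij_is_surj surj_f_inv_f)
  ultimately show ?case using step1 by (simp add: charge_insert)
next
  case (step2 c)
  have "{s. \<sigma> s \<le> c} = insert (inv \<sigma> c) {s. \<sigma> s \<le> c - 1}"
  proof (intro equalityI subsetI)
    fix s assume "s \<in> {s. \<sigma> s \<le> c}"
    then have "\<sigma> s \<le> c - 1 \<or> \<sigma> s = c" by auto
    then show "s \<in> insert (inv \<sigma> c) {s. \<sigma> s \<le> c - 1}"
      using assms(1) by (metis bij_inv_eq_iff insert_iff mem_Collect_eq)
  qed (use assms(1) in \<open>auto simp: bij_is_surj surj_f_inv_f\<close>)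
  moreover have "inv \<sigma> c \<notin> {s. \<sigma> s \<le> c - 1}"
    using assms(1) by (simp add: bij_is_surj surj_f_inv_f)
  ultimately show ?case using step2
    by (metis add_diff_cancel_right' charge_insert sea_insert)
qed

lemma second_class_set_card:
  assumes "bij \<sigma>"
  shows "finite {s. c < \<sigma> s \<and> \<sigma> s \<le> c + int d}" "card {s. c < \<sigma> s \<and> \<sigma> s \<le> c + int d} = d"
proof -
  have "{s. c < \<sigma> s \<and> \<sigma> s \<le> c + int d} = \<sigma> -` {c<..c + int d}" by auto
  then show "finite {s. c < \<sigma> s \<and> \<sigma> s \<le> c + int d}" "card {s. c < \<sigma> s \<and> \<sigma> s \<le> c + int d} = d"
    using assms by (auto simp: finite_vimageI bij_is_inj card_vimage_inj bij_is_surj)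
qed

text \<open>
  On either event the order of the values at \<open>i\<close> and \<open>i + 1\<close> is forced by the classes, so
  that the condition on this order in the swap relation holds automatically.
\<close>
lemma class_event_swap:
  assumes "is_mallows_measure q M" "0 < q" "A \<inter> X = {}"
    and desc: "i \<notin> A \<and> i + 1 \<in> A \<or> i \<notin> A \<union> X \<and> i + 1 \<in> X"
  shows "emeasure M (class_event c d A X) =
    ennreal q * emeasure M (class_event c d (adj_swap i ` A) (adj_swap i ` X))"
proof -
  let ?t = "adj_swap i"
  let ?B = "class_event c d (?t ` A) (?t ` X)"
  have M: "finite_measure M" "sets M = sets permutations_Z" "q_exchangeable q M"
    using assms(1) by (auto simp: is_mallows_measure_def prob_space.finite_measure)
  have sp: "space M = {\<omega>. bij \<omega>}" using sets_eq_imp_space_eq[OF M(2)] by simp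
  have im: "{s. P (\<sigma> (?t s))} = ?t ` S \<longleftrightarrow> {s. P (\<sigma> s)} = S" for P and \<sigma> :: "int \<Rightarrow> int" and S
  proof -
    have "{s. P (\<sigma> (?t s))} = ?t ` {s. P (\<sigma> s)}"
      by (auto simp: image_iff) (metis transpose_involutory)
    then show ?thesis by (metis inj_image_eq_iff inj_transpose)
  qed
  have 1: "{\<sigma>\<in>space M. \<sigma> \<circ> ?t \<in> ?B \<and> \<sigma> (i + 1) < \<sigma> i} = class_event c d A X"
  proof -
    have "bij (\<sigma> \<circ> ?t) \<longleftrightarrow> bij \<sigma>" for \<sigma> :: "int \<Rightarrow> int"
      by (meson bij_betw_comp_iff bij_transpose)
    then have "\<sigma> \<circ> ?t \<in> ?B \<longleftrightarrow> \<sigma> \<in> class_event c d A X" for \<sigma>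
      using im[of "\<lambda>v. v \<le> c" \<sigma> A] im[of "\<lambda>v. c < v \<and> v \<le> c + int d" \<sigma> X]
      unfolding class_event_def mem_Collect_eq comp_def by simp
    moreover have "\<sigma> (i + 1) < \<sigma> i" if "\<sigma> \<in> class_event c d A X" for \<sigma>
      using that desc assms(3) by (auto simp: class_event_def)
    ultimately show ?thesis by (auto simp: sp class_event_def)
  qed
  have 2: "{\<sigma>\<in>space M. \<sigma> \<in> ?B \<and> \<sigma> i < \<sigma> (i + 1)} = ?B"
  proof -
    have *: "i \<in> ?t ` A \<longleftrightarrow> i + 1 \<in> A" "i + 1 \<in> ?t ` A \<longleftrightarrow> i \<in> A"
      "i \<in> ?t ` X \<longleftrightarrow> i + 1 \<in> X" "i + 1 \<in> ?t ` X \<longleftrightarrow> i \<in> X"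
      by (auto simp: adj_swap_image)
    have "\<sigma> i < \<sigma> (i + 1)" if "\<sigma> \<in> ?B" for \<sigma>
    proof -
      have "\<sigma> i \<le> c \<longleftrightarrow> i + 1 \<in> A" "\<sigma> (i + 1) \<le> c \<longleftrightarrow> i \<in> A"
        "c < \<sigma> i \<and> \<sigma> i \<le> c + int d \<longleftrightarrow> i + 1 \<in> X" "c < \<sigma> (i + 1) \<and> \<sigma> (i + 1) \<le> c + int d \<longleftrightarrow> i \<in> X"
        using that unfolding *[symmetric] class_event_def by blast+
      then show ?thesis using desc assms(3) by auto
    qed
    then show ?thesis by (auto simp: sp class_event_def)
  qed
  show ?thesis
    using q_exchangeable_swap[OF M assms(2) class_event_sets, of i c d "?t ` A" "?t ` X"]
    unfolding 1 2 .
qed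

text \<open>
  Induction on the energy: a configuration other than the ground state has an adjacent swap that
  lowers its energy by one, and the probability changes by the matching factor \<open>q\<close>.
\<close>
lemma class_event_gibbs:
  assumes M: "is_mallows_measure q M" and q: "0 < q"
  obtains k where "0 \<le> k"
    "\<And>A X. config A X \<Longrightarrow> charge A = c \<Longrightarrow> card X = d \<Longrightarrow>
       emeasure M (class_event c d A X) = ennreal (k * q powr energy A X)"
proof -
  interpret prob_space M using M by (simp add: is_mallows_measure_def)
  let ?G = "class_event c d {..c} {c<..c + int d}"
  \<comment> \<open>The choice that makes the formula true for the ground state.\<close>
  define k where "k = measure M ?G / q powr energy {..c} {c<..c + int d}"
  have "measure M (class_event c d A X) = k * q powr energy A X"
    if "config A X" "charge A = c" "card X = d" "energy A X < real n" for A X n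
    using that
  proof (induction n arbitrary: A X)
    case 0
    then show ?case using energy_nonneg[of A X] by simp
  next
    case (Suc n)
    show ?case
    proof (cases "\<exists>i. i \<notin> A \<and> i + 1 \<in> A \<or> i \<notin> A \<union> X \<and> i + 1 \<in> X")
      case True
      then obtain i where i: "i \<notin> A \<and> i + 1 \<in> A \<or> i \<notin> A \<union> X \<and> i + 1 \<in> X" by blast
      let ?A = "adj_swap i ` A" and ?X = "adj_swap i ` X"
      have AX: "sea A" "finite X" "A \<inter> X = {}" using Suc.prems by (auto simp: config_def)
      have e: "energy ?A ?X = energy A X - 1"
        using i energy_swap_sea[OF Suc.prems(1)] energy_swap_second_class[OF Suc.prems(1)] by blast
      have "charge ?A = c"
        using i AX Suc.prems(2) by (auto simp: adj_swap_image charge_move)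
      moreover have "card ?X = d"
        using Suc.prems(3) by (simp add: card_image)
      ultimately have IH: "measure M (class_event c d ?A ?X) = k * q powr energy ?A ?X"
        using Suc.prems e by (intro Suc.IH config_swap) auto
      have "emeasure M (class_event c d A X) = ennreal q * emeasure M (class_event c d ?A ?X)"
        using class_event_swap[OF M q AX(3) i] .
      then have "measure M (class_event c d A X) = q * measure M (class_event c d ?A ?X)"
        using q by (simp add: emeasure_eq_measure ennreal_mult[symmetric])
      also have "\<dots> = k * (q powr 1 * q powr energy ?A ?X)" using IH q by simp
      also have "\<dots> = k * q powr energy A X" unfolding powr_add[symmetric] e by simp
      finally show ?thesis .
    next
      case False
      then have "A = {..charge A} \<and> X = {charge A<..charge A + int (card X)}"
        using Suc.prems(1) by (intro config_ground_state) auto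
      then have "A = {..c}" "X = {c<..c + int d}" using Suc.prems by auto
      then show ?thesis using q by (simp add: k_def)
    qed
  qed
  then have "emeasure M (class_event c d A X) = ennreal (k * q powr energy A X)"
    if "config A X" "charge A = c" "card X = d" for A X
    using that reals_Archimedean2[of "energy A X"] by (auto simp: emeasure_eq_measure)
  moreover have "0 \<le> k" by (simp add: k_def)
  ultimately show ?thesis using that by blast
qed

definition configs :: "int \<Rightarrow> nat \<Rightarrow> (int set \<times> int set) set" where
  "configs c d = {(A, X). config A X \<and> charge A = c \<and> card X = d}"

lemma countable_configs: "countable (configs c d)"
  by (rule countable_subset[of _ "Collect sea \<times> Collect finite"])
    (auto simp: configs_def config_def countable_seas countable_Collect_finite)

lemma AE_class_event:
  assumes M: "is_mallows_measure q M"
  shows "AE \<sigma> in M. \<sigma> \<in> (\<Union>(A, X)\<in>configs c d. class_event c d A X)"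
proof -
  have sp: "space M = {\<omega>. bij \<omega>}"
    using M sets_eq_imp_space_eq[of M permutations_Z] by (simp add: is_mallows_measure_def)
  have "AE \<sigma> in M. balanced \<sigma>" using M by (simp add: is_mallows_measure_def)
  then show ?thesis
  proof (rule AE_mp, intro AE_I2 impI)
    fix \<sigma> assume "\<sigma> \<in> space M" "balanced \<sigma>"
    then have b: "bij \<sigma>" and s: "sea {s. \<sigma> s \<le> c} \<and> charge {s. \<sigma> s \<le> c} = c"
      using sp sea_of_balanced by auto
    have "({s. \<sigma> s \<le> c}, {s. c < \<sigma> s \<and> \<sigma> s \<le> c + int d}) \<in> configs c d"
      using s second_class_set_card[OF b, of c d] by (auto simp: configs_def config_def)
    moreover have "\<sigma> \<in> class_event c d {s. \<sigma> s \<le> c} {s. c < \<sigma> s \<and> \<sigma> s \<le> c + int d}"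
      using b by (simp add: class_event_def)
    ultimately show "\<sigma> \<in> (\<Union>(A, X)\<in>configs c d. class_event c d A X)" by force
  qed
qed

text \<open>
  Almost surely the permutation is balanced, and then the threshold \<open>c\<close> produces charge \<open>c\<close>.
\<close>
lemma sum_class_events:
  assumes M: "is_mallows_measure q M"
  shows "(\<integral>\<^sup>+p. emeasure M (class_event c d (fst p) (snd p)) \<partial>count_space (configs c d)) = 1"
proof -
  interpret prob_space M using M by (simp add: is_mallows_measure_def)
  have sM: "sets M = sets permutations_Z" using M by (simp add: is_mallows_measure_def)
  have ev: "(\<Union>p\<in>configs c d. class_event c d (fst p) (snd p)) \<in> events"
    using countable_configs class_event_sets sM by (intro sets.countable_UN'') auto
  have "(\<integral>\<^sup>+p. emeasure M (class_event c d (fst p) (snd p)) \<partial>count_space (configs c d)) =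
    emeasure M (\<Union>p\<in>configs c d. class_event c d (fst p) (snd p))"
    using countable_configs class_event_sets sM
    by (intro emeasure_UN_countable[symmetric]) (auto simp: disjoint_family_on_def class_event_def)
  also have "\<dots> = 1"
    using AE_class_event[OF M, of c d] ev
    by (intro emeasure_eq_1_AE) (auto simp: case_prod_beta)
  finally show ?thesis .
qed

lemma bij_betw_translate_configs:
  "bij_betw (\<lambda>(A, X). ((\<lambda>s. s + 1) ` A, (\<lambda>s. s + 1) ` X)) (configs c d) (configs (c + 1) d)"
proof (rule bij_betwI[where g = "\<lambda>(A, X). ((\<lambda>s. s - 1) ` A, (\<lambda>s. s - 1) ` X)"])
  have ii: "(\<lambda>s::int. s + 1) ` (\<lambda>s. s - 1) ` S = S" "(\<lambda>s::int. s - 1) ` (\<lambda>s. s + 1) ` S = S" for S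
    by (simp_all add: image_image)
  have *: "config ((\<lambda>s. s + 1) ` A) ((\<lambda>s. s + 1) ` X)" if "config A X" for A X
    using that by (auto simp: config_def sea_translate)
  show "(\<lambda>(A, X). ((\<lambda>s. s + 1) ` A, (\<lambda>s. s + 1) ` X)) \<in> configs c d \<rightarrow> configs (c + 1) d"
    using * by (auto simp: configs_def sea_translate config_def card_image)
  have sm: "sea ((\<lambda>s. s - 1) ` A)" if "sea A" for A
  proof -
    have "(\<lambda>s. s - 1) ` A \<inter> {0<..} \<subseteq> (\<lambda>s. s - 1) ` (A \<inter> {0<..})" by auto
    moreover have "{..0} - (\<lambda>s. s - 1) ` A \<subseteq> insert 0 ((\<lambda>s. s - 1) ` ({..0} - A))"
    proof
      fix x assume x: "x \<in> {..0} - (\<lambda>s. s - 1) ` A"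
      then have "x + 1 \<notin> A" by (auto simp: image_iff)
      then show "x \<in> insert 0 ((\<lambda>s. s - 1) ` ({..0} - A))"
        using x by (cases "x = 0") (auto simp: image_iff intro!: bexI[of _ "x + 1"])
    qed
    ultimately show ?thesis using that unfolding sea_def
      by (meson finite_imageI finite_insert finite_subset)
  qed
  show "(\<lambda>(A, X). ((\<lambda>s. s - 1) ` A, (\<lambda>s. s - 1) ` X)) \<in> configs (c + 1) d \<rightarrow> configs c d"
  proof safe
    fix A X assume "(A, X) \<in> configs (c + 1) d"
    then have AX: "sea A" "finite X" "A \<inter> X = {}" "charge A = c + 1" "card X = d"
      by (auto simp: configs_def config_def)
    have "charge ((\<lambda>s. s - 1) ` A) = c" using sea_translate(2)[OF sm[OF AX(1)]] AX(4) by (simp add: ii)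
    then show "((\<lambda>s. s - 1) ` A, (\<lambda>s. s - 1) ` X) \<in> configs c d"
      using AX sm by (auto simp: configs_def config_def card_image inj_on_def)
  qed
qed (auto simp: image_image)

text \<open>
  Translation by one site is a bijection of the configurations under which every energy
  grows by the same amount \<open>c + 1/2\<close>.
\<close>
lemma partition_function_translate:
  assumes "0 < q"
  shows "(\<integral>\<^sup>+p. ennreal (q powr energy (fst p) (snd p)) \<partial>count_space (configs (c + 1) d)) =
    ennreal (q powr (real_of_int c + 1 / 2)) *
    (\<integral>\<^sup>+p. ennreal (q powr energy (fst p) (snd p)) \<partial>count_space (configs c d))"
proof -
  let ?f = "\<lambda>(A, X). ((\<lambda>s::int. s + 1) ` A, (\<lambda>s::int. s + 1) ` X)"
  have "(\<integral>\<^sup>+p. ennreal (q powr energy (fst p) (snd p)) \<partial>count_space (configs (c + 1) d)) =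
    (\<integral>\<^sup>+p. ennreal (q powr energy (fst (?f p)) (snd (?f p))) \<partial>count_space (configs c d))"
    by (rule nn_integral_bij_count_space[OF bij_betw_translate_configs, symmetric])
  also have "\<dots> = (\<integral>\<^sup>+p. ennreal (q powr (real_of_int c + 1 / 2)) *
      ennreal (q powr energy (fst p) (snd p)) \<partial>count_space (configs c d))"
  proof (rule nn_integral_cong)
    fix p assume "p \<in> space (count_space (configs c d))"
    then have "config (fst p) (snd p)" "charge (fst p) = c" by (auto simp: configs_def)
    then show "ennreal (q powr energy (fst (?f p)) (snd (?f p))) =
      ennreal (q powr (real_of_int c + 1 / 2)) * ennreal (q powr energy (fst p) (snd p))"
      using energy_translate[of "fst p" "snd p"]
      by (simp add: case_prod_beta ennreal_mult[symmetric] powr_add[symmetric] add_ac)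
  qed
  finally show ?thesis by (simp add: nn_integral_cmult)
qed

section \<open>Gibbs law of the classes under the product measure\<close>

text \<open>
  The infinite products in the weight do not depend on \<open>c\<close> and cancel.
\<close>
lemma mallows_weight_Suc:
  assumes "0 < q" "0 < \<alpha>"
  shows "mallows_weight q \<alpha> (c + 1) = \<alpha> * q powr (real_of_int c + 1 / 2) * mallows_weight q \<alpha> c"
proof -
  have "q powr ((real_of_int (c + 1))\<^sup>2 / 2) = q powr (real_of_int c + 1 / 2) * q powr ((real_of_int c)\<^sup>2 / 2)"
    unfolding powr_add[symmetric] by (simp add: power2_eq_square field_simps)
  moreover have "\<alpha> powi (c + 1) = \<alpha> * \<alpha> powi c" using assms by (simp add: power_int_add)
  ultimately show ?thesis by (simp add: mallows_weight_def)
qed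

text \<open>
  Both constants are reciprocals of partition functions, and translation relates the latter.
\<close>
lemma gibbs_constant_step:
  assumes M: "is_mallows_measure q M" and q: "0 < q"
    and k: "0 \<le> k" "\<And>A X. config A X \<Longrightarrow> charge A = c \<Longrightarrow> card X = d \<Longrightarrow>
       emeasure M (class_event c d A X) = ennreal (k * q powr energy A X)"
    and k': "0 \<le> k'" "\<And>A X. config A X \<Longrightarrow> charge A = c + 1 \<Longrightarrow> card X = d \<Longrightarrow>
       emeasure M (class_event (c + 1) d A X) = ennreal (k' * q powr energy A X)"
  shows "k' * q powr (real_of_int c + 1 / 2) = k"
proof -
  let ?Z = "\<lambda>c. \<integral>\<^sup>+p. ennreal (q powr energy (fst p) (snd p)) \<partial>count_space (configs c d)"
  have "ennreal k * ?Z c = (\<integral>\<^sup>+p. emeasure M (class_event c d (fst p) (snd p)) \<partial>count_space (configs c d))"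
    using k by (subst nn_integral_cmult[symmetric])
      (auto intro!: nn_integral_cong simp: ennreal_mult configs_def)
  then have 1: "ennreal k * ?Z c = 1" using sum_class_events[OF M] by simp
  have "ennreal k' * ?Z (c + 1) = (\<integral>\<^sup>+p. emeasure M (class_event (c + 1) d (fst p) (snd p)) \<partial>count_space (configs (c + 1) d))"
    using k' by (subst nn_integral_cmult[symmetric])
      (auto intro!: nn_integral_cong simp: ennreal_mult configs_def)
  then have "ennreal k' * ?Z (c + 1) = 1" using sum_class_events[OF M] by simp
  then have 2: "ennreal (k' * q powr (real_of_int c + 1 / 2)) * ?Z c = 1"
    using k' q by (simp add: partition_function_translate ennreal_mult mult.assoc)
  have "ennreal (k' * q powr (real_of_int c + 1 / 2)) =
    ennreal (k' * q powr (real_of_int c + 1 / 2)) * (ennreal k * ?Z c)" unfolding 1 by simp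
  also have "\<dots> = ennreal k * (ennreal (k' * q powr (real_of_int c + 1 / 2)) * ?Z c)" by (rule mult.left_commute)
  also have "\<dots> = ennreal k" unfolding 2 by simp
  finally show ?thesis using k k' by (simp add: ennreal_inj)
qed

lemma bij_shift_iff: "bij (\<lambda>i. \<sigma> i - c) \<longleftrightarrow> bij \<sigma>" for \<sigma> :: "int \<Rightarrow> int"
proof
  have "bij (\<lambda>v::int. v - c)" for c by (rule bij_betwI[where g = "\<lambda>v. v + c"]) auto
  from bij_comp[OF _ this] show "bij \<sigma> \<Longrightarrow> bij (\<lambda>i. \<sigma> i - c)" by (simp add: comp_def)
  show "bij (\<lambda>i. \<sigma> i - c) \<Longrightarrow> bij \<sigma>"
    using bij_comp[OF _ \<open>\<And>c. bij (\<lambda>v::int. v - c)\<close>, of "\<lambda>i. \<sigma> i - c" "- c"] by (simp add: comp_def)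
qed

lemma emeasure_shifted_measure:
  assumes M: "is_mallows_measure q M" and B: "B \<in> sets permutations_Z"
  shows "emeasure (shifted_measure M c) B = emeasure M {\<sigma>. bij \<sigma> \<and> (\<lambda>i. \<sigma> i - c) \<in> B}"
proof -
  have sM: "sets M = sets permutations_Z" using M by (simp add: is_mallows_measure_def)
  have sp: "space M = {\<omega>. bij \<omega>}" using sets_eq_imp_space_eq[OF sM] by simp
  have "(\<lambda>\<sigma> i. \<sigma> i - c) \<in> measurable permutations_Z permutations_Z"
  proof (rule measurable_to_permutations_Z)
    show "(\<lambda>\<sigma>. \<sigma> i - c) \<in> measurable permutations_Z (count_space UNIV)" for i
      by (rule measurable_compose[OF measurable_coordinate]) simp
  qed (simp add: bij_shift_iff)
  then have "(\<lambda>\<sigma> i. \<sigma> i - c) \<in> measurable M permutations_Z"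
    by (simp add: measurable_cong_sets[OF sM refl])
  then have "emeasure (shifted_measure M c) B = emeasure M ((\<lambda>\<sigma> i. \<sigma> i - c) -` B \<inter> space M)"
    unfolding shifted_measure_def using B by (rule emeasure_distr)
  also have "(\<lambda>\<sigma> i. \<sigma> i - c) -` B \<inter> space M = {\<sigma>. bij \<sigma> \<and> (\<lambda>i. \<sigma> i - c) \<in> B}"
    by (auto simp: sp)
  finally show ?thesis .
qed

lemma AE_sea:
  assumes "is_mallows_measure q M"
  shows "AE \<sigma> in M. bij \<sigma> \<and> sea {s. \<sigma> s \<le> c} \<and> charge {s. \<sigma> s \<le> c} = c"
proof -
  have sp: "space M = {\<omega>. bij \<omega>}"
    using assms sets_eq_imp_space_eq[of M permutations_Z] by (simp add: is_mallows_measure_def)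
  have "AE \<sigma> in M. balanced \<sigma>" using assms by (simp add: is_mallows_measure_def)
  then show ?thesis
    by (rule AE_mp) (auto intro!: AE_I2 simp: sp sea_of_balanced)
qed

lemma emeasure_eq_0_if_unbalanced:
  assumes M: "is_mallows_measure q M"
    and B: "\<And>\<sigma>. \<sigma> \<in> B \<Longrightarrow> bij \<sigma> \<and> \<not> (sea {s. \<sigma> s \<le> c} \<and> charge {s. \<sigma> s \<le> c} = c)"
  shows "emeasure M B = 0"
proof -
  have sp: "space M = {\<omega>. bij \<omega>}"
    using M sets_eq_imp_space_eq[of M permutations_Z] by (simp add: is_mallows_measure_def)
  have "AE \<sigma> in M. \<not> \<sigma> \<in> B"
    using AE_sea[OF M, of c] by (rule AE_mp) (use B in blast)
  then have "emeasure M {\<sigma>\<in>space M. \<sigma> \<in> B} = 0" by (rule emeasure_eq_0_AE)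
  also have "{\<sigma>\<in>space M. \<sigma> \<in> B} = B" using B by (auto simp: sp)
  finally show ?thesis .
qed

text \<open>
  A configuration has a single charge, so only one term of the mixture charges it.  The product of
  the mixture weight and the constant for that charge is geometric in the charge with ratio \<open>\<alpha>\<close>.
\<close>
lemma product_measure_gibbs:
  assumes M: "is_mallows_measure q M" and q: "0 < q" "0 < \<alpha>"
  obtains K where "0 \<le> K"
    "\<And>A X. config A X \<Longrightarrow> card X = d \<Longrightarrow>
       emeasure (mallows_product_measure q \<alpha> M) (class_event 0 d A X) =
       ennreal (K * \<alpha> powi charge A * q powr energy A X)"
proof -
  have "\<exists>k. 0 \<le> k \<and> (\<forall>A X. config A X \<longrightarrow> charge A = c \<longrightarrow> card X = d \<longrightarrow>
       emeasure M (class_event c d A X) = ennreal (k * q powr energy A X))" for c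
    using class_event_gibbs[OF M q(1), of c d] by metis
  then obtain k where k: "\<And>c. 0 \<le> k c" "\<And>c A X. config A X \<Longrightarrow> charge A = c \<Longrightarrow> card X = d \<Longrightarrow>
       emeasure M (class_event c d A X) = ennreal (k c * q powr energy A X)"
    by metis
  \<comment> \<open>Cutting the weight off at zero matches \<open>ennreal\<close>, and keeps the recursion in \<open>c\<close>.\<close>
  define W where "W c = max 0 (mallows_weight q \<alpha> c) * k c" for c
  have step: "W (c + 1) = \<alpha> * W c" for c
  proof -
    have kk: "k (c + 1) * q powr (real_of_int c + 1 / 2) = k c"
      using k by (intro gibbs_constant_step[OF M q(1), of _ c d]) auto
    have "max 0 (mallows_weight q \<alpha> (c + 1)) = \<alpha> * q powr (real_of_int c + 1 / 2) * max 0 (mallows_weight q \<alpha> c)"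
      using q by (simp add: mallows_weight_Suc max_def zero_le_mult_iff mult_le_0_iff not_le)
    then show ?thesis unfolding W_def kk[symmetric] by (simp add: ac_simps)
  qed
  have W: "W c = W 0 * \<alpha> powi c" for c
  proof (induction c rule: int_induct[where k = 0])
    case (step1 i)
    then show ?case using step[of i] q by (simp add: power_int_add)
  next
    case (step2 i)
    then show ?case using step[of "i - 1"] q by (simp add: power_int_diff field_simps)
  qed simp
  have "emeasure (mallows_product_measure q \<alpha> M) (class_event 0 d A X) =
       ennreal (W 0 * \<alpha> powi charge A * q powr energy A X)" if AX: "config A X" "card X = d" for A X
  proof -
    have sh: "emeasure (shifted_measure M c) (class_event 0 d A X) = emeasure M (class_event c d A X)" for c
      unfolding emeasure_shifted_measure[OF M class_event_sets]
      by (rule arg_cong[where f = "emeasure M"]) (auto simp: class_event_def bij_shift_iff)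
    have null: "emeasure M (class_event c d A X) = 0" if "c \<noteq> charge A" for c
      using that by (intro emeasure_eq_0_if_unbalanced[OF M, of _ c]) (auto simp: class_event_def)
    have "emeasure (mallows_product_measure q \<alpha> M) (class_event 0 d A X) =
      (\<integral>\<^sup>+c. ennreal (mallows_weight q \<alpha> c) * emeasure M (class_event c d A X) \<partial>count_space UNIV)"
      by (simp add: emeasure_mallows_product_measure class_event_sets sh)
    also have "\<dots> = (\<Sum>c\<in>{charge A}. ennreal (mallows_weight q \<alpha> c) * emeasure M (class_event c d A X))"
      by (rule nn_integral_count_space') (auto simp: null)
    also have "\<dots> = ennreal (max 0 (mallows_weight q \<alpha> (charge A))) * ennreal (k (charge A) * q powr energy A X)"
      using AX k(2) by (simp add: ennreal_max_0 max.commute)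
    also have "\<dots> = ennreal (W (charge A) * q powr energy A X)"
      using k(1)[of "charge A"] by (subst ennreal_mult[symmetric]) (auto simp: W_def mult.assoc)
    finally show ?thesis unfolding W[of "charge A"] .
  qed
  moreover have "0 \<le> W 0" using k(1) by (simp add: W_def)
  ultimately show ?thesis using that by blast
qed

lemma product_measure_nonsea_null:
  assumes M: "is_mallows_measure q M"
  shows "emeasure (mallows_product_measure q \<alpha> M) {\<sigma>. bij \<sigma> \<and> \<not> sea {s. \<sigma> s \<le> 0}} = 0"
    and "{\<sigma>. bij \<sigma> \<and> \<not> sea {s. \<sigma> s \<le> 0}} \<in> sets permutations_Z"
proof -
  let ?N = "{\<sigma>::int \<Rightarrow> int. bij \<sigma> \<and> \<not> sea {s. \<sigma> s \<le> 0}}"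
  have "?N = space permutations_Z - (\<Union>A\<in>Collect sea. {\<sigma>. bij \<sigma> \<and> {s. \<sigma> s \<le> 0} = A})" by auto
  also have "\<dots> \<in> sets permutations_Z"
    by (intro sets.Diff sets.top sets.countable_UN' countable_seas) (auto intro: preimage_event_sets)
  finally show N: "?N \<in> sets permutations_Z" .
  have "emeasure (shifted_measure M c) ?N = 0" for c
  proof -
    have "emeasure M {\<sigma>. bij \<sigma> \<and> (\<lambda>i. \<sigma> i - c) \<in> ?N} = 0"
      by (rule emeasure_eq_0_if_unbalanced[OF M, of _ c]) auto
    then show ?thesis by (simp only: emeasure_shifted_measure[OF M N])
  qed
  then show "emeasure (mallows_product_measure q \<alpha> M) ?N = 0"
    by (simp add: emeasure_mallows_product_measure N)
qed

section \<open>A jump of one second class particle\<close>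

definition second_class_event :: "nat \<Rightarrow> int set \<Rightarrow> (int \<Rightarrow> int) set" where
  "second_class_event d X = {\<sigma>. bij \<sigma> \<and> {s. 0 < \<sigma> s \<and> \<sigma> s \<le> int d} = X}"

lemma second_class_event_sets: "second_class_event d X \<in> sets permutations_Z"
  unfolding second_class_event_def by (rule preimage_event_sets)

definition config_weight :: "real \<Rightarrow> real \<Rightarrow> int set \<Rightarrow> int set \<Rightarrow> real" where
  "config_weight q \<alpha> A X = \<alpha> powi charge A * q powr energy A X"

lemma config_weight_nonneg: "0 < \<alpha> \<Longrightarrow> 0 \<le> config_weight q \<alpha> A X"
  by (simp add: config_weight_def)

lemma config_weight_fill:
  assumes "0 < q" "0 < \<alpha>" "config A X" "s \<notin> A" "s \<notin> X"
  shows "config_weight q \<alpha> (insert s A) X =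
    config_weight q \<alpha> A X * (\<alpha> * q powr (real_of_int s - 1 / 2 - real (card {x\<in>X. s < x})))"
  unfolding config_weight_def energy_fill[OF assms(3-5)]
  using assms by (simp add: powr_add charge_insert config_def power_int_add)

text \<open>
  Sums out the first class particles.  The terms are paired according to whether the distinguished
  site \<open>t\<close> is a hole or a first class site, so that \<open>A\<close> runs through the seas that avoid \<open>t\<close>.
\<close>
lemma second_class_event_split:
  assumes N: "sets N = sets permutations_Z"
    and null: "emeasure N {\<sigma>. bij \<sigma> \<and> \<not> sea {s. \<sigma> s \<le> 0}} = 0"
      "{\<sigma>. bij \<sigma> \<and> \<not> sea {s. \<sigma> s \<le> 0}} \<in> sets permutations_Z"
    and gibbs: "\<And>A X. config A X \<Longrightarrow> card X = d \<Longrightarrow>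
      emeasure N (class_event 0 d A X) = ennreal (K * config_weight q \<alpha> A X)"
    and K: "0 \<le> K" "0 < \<alpha>" and X: "finite X" "card X = d" "t \<notin> X"
  shows "emeasure N (second_class_event d X) =
    (\<integral>\<^sup>+A. ennreal (K * (config_weight q \<alpha> A X + config_weight q \<alpha> (insert t A) X))
      \<partial>count_space {A. sea A \<and> A \<inter> insert t X = {}})"
proof -
  let ?T = "{A. sea A \<and> A \<inter> insert t X = {}}"
  let ?U = "\<lambda>A. class_event 0 d A X \<union> class_event 0 d (insert t A) X"
  have cT: "countable ?T" by (rule countable_subset[OF _ countable_seas]) auto
  have U: "?U A \<in> sets N" for A unfolding N by (intro sets.Un class_event_sets)
  have sub: "second_class_event d X \<subseteq> (\<Union>A\<in>?T. ?U A) \<union> {\<sigma>. bij \<sigma> \<and> \<not> sea {s. \<sigma> s \<le> 0}}"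
  proof
    fix \<sigma> assume s: "\<sigma> \<in> second_class_event d X"
    show "\<sigma> \<in> (\<Union>A\<in>?T. ?U A) \<union> {\<sigma>. bij \<sigma> \<and> \<not> sea {s. \<sigma> s \<le> 0}}"
    proof (cases "sea {s. \<sigma> s \<le> 0}")
      case True
      define A where "A = {s. \<sigma> s \<le> 0} - {t}"
      have A: "A = {s. \<sigma> s \<le> 0} \<or> insert t A = {s. \<sigma> s \<le> 0}" by (auto simp: A_def)
      then have "\<sigma> \<in> ?U A" using s by (auto simp: class_event_def second_class_event_def)
      moreover have "sea A" using True A by (metis sea_insert)
      moreover have "A \<inter> insert t X = {}"
        using s by (auto simp: A_def second_class_event_def)
      ultimately show ?thesis by blast
    qed (use s in \<open>auto simp: second_class_event_def\<close>)
  qed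
  have "emeasure N (second_class_event d X) = emeasure N (\<Union>A\<in>?T. ?U A)"
  proof (rule antisym)
    have "emeasure N (second_class_event d X) \<le>
      emeasure N ((\<Union>A\<in>?T. ?U A) \<union> {\<sigma>. bij \<sigma> \<and> \<not> sea {s. \<sigma> s \<le> 0}})"
      using sub U null(2) cT by (intro emeasure_mono sets.Un sets.countable_UN') (auto simp: N)
    also have "\<dots> = emeasure N (\<Union>A\<in>?T. ?U A)"
      using U null cT by (intro emeasure_Un_null_set sets.countable_UN') (auto simp: null_sets_def N)
    finally show "emeasure N (second_class_event d X) \<le> emeasure N (\<Union>A\<in>?T. ?U A)" .
    show "emeasure N (\<Union>A\<in>?T. ?U A) \<le> emeasure N (second_class_event d X)"
      by (rule emeasure_mono)
        (use second_class_event_sets N in \<open>auto simp: class_event_def second_class_event_def\<close>)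
  qed
  also have "\<dots> = (\<integral>\<^sup>+A. emeasure N (?U A) \<partial>count_space ?T)"
  proof (rule emeasure_UN_countable[OF U cT])
    have "A = {s. \<sigma> s \<le> 0} - {t}" if "A \<in> ?T" "\<sigma> \<in> ?U A" for A \<sigma>
      using that by (auto simp: class_event_def)
    then show "disjoint_family_on ?U ?T"
      unfolding disjoint_family_on_def by blast
  qed
  also have "\<dots> = (\<integral>\<^sup>+A. ennreal (K * (config_weight q \<alpha> A X + config_weight q \<alpha> (insert t A) X)) \<partial>count_space ?T)"
  proof (rule nn_integral_cong)
    fix A assume "A \<in> space (count_space ?T)"
    then have A: "sea A" "A \<inter> X = {}" "t \<notin> A" by auto
    then have c: "config A X" "config (insert t A) X" using X by (auto simp: config_def)
    have "emeasure N (?U A) = emeasure N (class_event 0 d A X) + emeasure N (class_event 0 d (insert t A) X)"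
    proof (rule plus_emeasure[symmetric])
      show "class_event 0 d A X \<inter> class_event 0 d (insert t A) X = {}"
        using A(3) by (auto simp: class_event_def)
    qed (simp_all add: N class_event_sets)
    also have "\<dots> = ennreal (K * (config_weight q \<alpha> A X + config_weight q \<alpha> (insert t A) X))"
      using c gibbs X K by (simp add: config_weight_nonneg ennreal_plus[symmetric] distrib_left del: ennreal_plus)
    finally show "emeasure N (?U A) = ennreal (K * (config_weight q \<alpha> A X + config_weight q \<alpha> (insert t A) X))" .
  qed
  finally show ?thesis .
qed

text \<open>
  Both probabilities are sums over the seas \<open>A\<close> that avoid \<open>i\<close> and \<open>i + 1\<close>, where the site next to the
  second class particle is a hole or first class.  Relative to the particle at \<open>i\<close> with a hole
  at \<open>i + 1\<close>, the weights are \<open>r\<close> for a first class site at \<open>i + 1\<close>, and after the jump \<open>q\<close> and \<open>r / q\<close>, since the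
  jump creates an inversion with a hole and removes one with a first class particle.  As these factors
  are the same for all \<open>A\<close>, they come out of the sums.
\<close>
lemma second_class_event_step:
  assumes N: "finite_measure N" "sets N = sets permutations_Z"
    and null: "emeasure N {\<sigma>. bij \<sigma> \<and> \<not> sea {s. \<sigma> s \<le> 0}} = 0"
      "{\<sigma>. bij \<sigma> \<and> \<not> sea {s. \<sigma> s \<le> 0}} \<in> sets permutations_Z"
    and gibbs: "\<And>A X. config A X \<Longrightarrow> card X = d \<Longrightarrow>
      emeasure N (class_event 0 d A X) = ennreal (K * config_weight q \<alpha> A X)"
    and K: "0 \<le> K" "0 < \<alpha>" "0 < q" and X: "finite X" "card X = d" "i \<in> X" "i + 1 \<notin> X"
    and r: "r = \<alpha> * q powr (real_of_int i + 1 / 2 - real (card {x\<in>X. i + 1 < x}))"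
  shows "measure N (second_class_event d (insert (i + 1) (X - {i}))) * (1 + r) =
    measure N (second_class_event d X) * (q + r / q)"
proof -
  interpret finite_measure N by fact
  let ?X = "insert (i + 1) (X - {i})"
  let ?T = "{A. sea A \<and> A \<inter> insert (i + 1) X = {}}"
  have r0: "0 \<le> r" using r K by simp
  have X': "finite ?X" "card ?X = d" "i \<notin> ?X" using X by (auto simp: card_insert_if)
    (metis Suc_pred card_gt_0_iff empty_iff)
  note split = second_class_event_split[of N d K q \<alpha>, OF N(2) null gibbs K(1,2)]
  define I where "I = (\<integral>\<^sup>+A. ennreal (K * config_weight q \<alpha> A X) \<partial>count_space ?T)"
  have "emeasure N (second_class_event d X) = (\<integral>\<^sup>+A. ennreal (1 + r) * ennreal (K * config_weight q \<alpha> A X) \<partial>count_space ?T)"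
  proof (subst split[OF _ _ X(1,2,4)], assumption, assumption, rule nn_integral_cong)
    fix A assume "A \<in> space (count_space ?T)"
    then have A: "config A X" "i + 1 \<notin> A" using X(1) by (auto simp: config_def)
    have "config_weight q \<alpha> (insert (i + 1) A) X = config_weight q \<alpha> A X * r"
      using config_weight_fill[OF K(3,2) A X(4)] by (simp add: r algebra_simps)
    then have "K * (config_weight q \<alpha> A X + config_weight q \<alpha> (insert (i + 1) A) X) =
      (1 + r) * (K * config_weight q \<alpha> A X)" by (simp add: algebra_simps)
    then show "ennreal (K * (config_weight q \<alpha> A X + config_weight q \<alpha> (insert (i + 1) A) X)) =
      ennreal (1 + r) * ennreal (K * config_weight q \<alpha> A X)"
      using r0 by (simp only: ennreal_mult' add_nonneg_nonneg zero_le_one)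
  qed
  then have FX: "emeasure N (second_class_event d X) = ennreal (1 + r) * I"
    by (simp add: nn_integral_cmult I_def)
  have T: "{A. sea A \<and> A \<inter> insert i ?X = {}} = ?T" using X(3) by auto
  have "emeasure N (second_class_event d ?X) = (\<integral>\<^sup>+A. ennreal (q + r / q) * ennreal (K * config_weight q \<alpha> A X) \<partial>count_space ?T)"
  proof (subst split[OF _ _ X'], assumption, assumption, unfold T, rule nn_integral_cong)
    fix A assume "A \<in> space (count_space ?T)"
    then have A: "config A X" "i \<notin> A" "i + 1 \<notin> A" "config A ?X" using X(1,3) by (auto simp: config_def)
    have sw: "adj_swap i ` A = A" "adj_swap i ` ?X = X" using A X(3,4) by (auto simp: adj_swap_image)
    have e: "energy A ?X = energy A X + 1"
      using energy_swap_second_class[OF A(4), of i] A X(3,4) unfolding sw by simp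
    have w: "config_weight q \<alpha> A ?X = q * config_weight q \<alpha> A X"
      using K by (simp add: config_weight_def e powr_add)
    have "{x\<in>?X. i < x} = insert (i + 1) {x\<in>X. i + 1 < x}" using X(4) by force
    then have c: "card {x\<in>?X. i < x} = Suc (card {x\<in>X. i + 1 < x})" using X(1) by simp
    have "config_weight q \<alpha> (insert i A) ?X = q * config_weight q \<alpha> A X *
      (\<alpha> * q powr (real_of_int i - 1 / 2 - real (Suc (card {x\<in>X. i + 1 < x}))))"
      using config_weight_fill[OF K(3,2) A(4,2) X'(3)] unfolding c w .
    also have "\<alpha> * q powr (real_of_int i - 1 / 2 - real (Suc (card {x\<in>X. i + 1 < x}))) = r * q powr (- 2)"
      unfolding r mult.assoc powr_add[symmetric] by (simp add: algebra_simps)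
    also have "q * config_weight q \<alpha> A X * (r * q powr (- 2)) = config_weight q \<alpha> A X * (r / q)"
      using K(3) by (simp add: powr_minus powr_numeral power2_eq_square field_simps)
    finally have "K * (config_weight q \<alpha> A ?X + config_weight q \<alpha> (insert i A) ?X) =
       (q + r / q) * (K * config_weight q \<alpha> A X)" unfolding w by (simp add: algebra_simps)
    then show "ennreal (K * (config_weight q \<alpha> A ?X + config_weight q \<alpha> (insert i A) ?X)) =
      ennreal (q + r / q) * ennreal (K * config_weight q \<alpha> A X)"
      using r0 K by (simp only: ennreal_mult' add_nonneg_nonneg divide_nonneg_pos less_imp_le)
  qed
  then have FX': "emeasure N (second_class_event d ?X) = ennreal (q + r / q) * I"
    by (simp add: nn_integral_cmult I_def)
  have "emeasure N (second_class_event d ?X) * ennreal (1 + r) = emeasure N (second_class_event d X) * ennreal (q + r / q)"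
    unfolding FX FX' by (simp add: ac_simps)
  then show ?thesis
    using r0 K by (simp add: emeasure_eq_measure ennreal_mult'[symmetric] ennreal_inj ennreal_mult''[symmetric] del: ennreal_plus)
qed

section \<open>Logistic functions and their telescoping products\<close>

definition logistic :: "real \<Rightarrow> real \<Rightarrow> int \<Rightarrow> real" where
  "logistic q \<alpha> y = 1 / (1 + \<alpha> * q powr (real_of_int y - 1 / 2))"

definition logistic_step :: "real \<Rightarrow> real \<Rightarrow> int \<Rightarrow> real" where
  "logistic_step q \<alpha> y = logistic q \<alpha> y - logistic q \<alpha> (y - 1)"

lemma logistic_pos: "0 < \<alpha> \<Longrightarrow> 0 < logistic q \<alpha> y"
  by (auto simp: logistic_def intro!: divide_pos_pos add_pos_nonneg)

lemma logistic_diff: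
  assumes "0 < q" "0 < \<alpha>"
  shows "logistic q \<alpha> y - logistic q \<alpha> (y - int m) =
    \<alpha> * q powr (real_of_int y - real m - 1 / 2) * (1 - q ^ m) * logistic q \<alpha> y * logistic q \<alpha> (y - int m)"
proof -
  define t where "t = \<alpha> * q powr (real_of_int y - real m - 1 / 2)"
  have t: "0 < t" using assms by (simp add: t_def)
  have "\<alpha> * q powr (real_of_int y - 1 / 2) = \<alpha> * (q powr (real_of_int y - real m - 1 / 2) * q powr real m)"
    unfolding powr_add[symmetric] by simp
  then have 1: "\<alpha> * q powr (real_of_int y - 1 / 2) = t * q ^ m"
    using assms by (simp add: t_def powr_realpow)
  have 2: "\<alpha> * q powr (real_of_int (y - int m) - 1 / 2) = t"
    by (simp add: t_def)
  have "1 + t * q ^ m > 0" using t assms by (simp add: add_pos_pos)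
  then show ?thesis
    unfolding logistic_def 1 2 t_def[symmetric] using t by (simp add: field_simps)
qed

lemma logistic_step_eq:
  assumes "0 < q" "0 < \<alpha>"
  shows "logistic_step q \<alpha> y =
    \<alpha> * q powr (real_of_int y - 3 / 2) * (1 - q) * logistic q \<alpha> y * logistic q \<alpha> (y - 1)"
  using logistic_diff[OF assms, of y 1] by (simp add: logistic_step_def)

lemma logistic_step_pos: "0 < q \<Longrightarrow> q < 1 \<Longrightarrow> 0 < \<alpha> \<Longrightarrow> 0 < logistic_step q \<alpha> y"
  by (simp add: logistic_step_eq logistic_pos)

text \<open>
  The ratio of consecutive logistic steps is the ratio of probabilities in the jump relation of the
  \<open>j\<close>-th second class particle, when \<open>y = x\<^sub>j + j - d\<close>.
\<close>
lemma logistic_step_ratio: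
  assumes "0 < q" "0 < \<alpha>" and r: "r = \<alpha> * q powr (real_of_int y + 1 / 2)"
  shows "logistic_step q \<alpha> (y + 1) * (1 + r) = logistic_step q \<alpha> y * (q + r / q)"
proof -
  have r0: "0 < r" using assms by simp
  have 1: "logistic q \<alpha> (y + 1) * (1 + r) = 1"
    using r0 by (simp add: logistic_def r algebra_simps)
  have "q powr (real_of_int y - 3 / 2) = q powr (real_of_int y + 1 / 2) * q powr (- 2)"
    unfolding powr_add[symmetric] by simp
  moreover have "q powr (- 2) = 1 / q\<^sup>2" using assms(1) by (simp add: powr_minus_divide)
  moreover have "real_of_int (y - 1) - 1 / 2 = real_of_int y - 3 / 2" by simp
  ultimately have 2: "\<alpha> * q powr (real_of_int (y - 1) - 1 / 2) = r / q\<^sup>2"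
    unfolding r by (simp only: mult.assoc times_divide_eq_right mult_1_right)
  have "1 + r / q\<^sup>2 > 0" 
  proof -
    have "0 < r / q\<^sup>2" using r0 assms(1) by (intro divide_pos_pos zero_less_power)
    then show ?thesis by linarith
  qed
  then have 3: "logistic q \<alpha> (y - 1) * (q + r / q) = q"
  proof -
    have "q + r / q = q * (1 + r / q\<^sup>2)" using assms(1) by (simp add: field_simps power2_eq_square)
    then show ?thesis unfolding logistic_def 2 using \<open>1 + r / q\<^sup>2 > 0\<close> by simp
  qed
  have 4: "q powr (real_of_int (y + 1) - 3 / 2) = q * q powr (real_of_int y - 3 / 2)"
  proof -
    have "q powr (real_of_int (y + 1) - 3 / 2) = q powr 1 * q powr (real_of_int y - 3 / 2)"
      unfolding powr_add[symmetric] by simp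
    then show ?thesis using assms(1) by simp
  qed
  have "logistic_step q \<alpha> (y + 1) * (1 + r) =
    \<alpha> * (q * q powr (real_of_int y - 3 / 2)) * (1 - q) * logistic q \<alpha> y * (logistic q \<alpha> (y + 1) * (1 + r))"
    unfolding logistic_step_eq[OF assms(1,2)] 4 by simp
  also have "\<dots> = \<alpha> * q powr (real_of_int y - 3 / 2) * (1 - q) * logistic q \<alpha> y * (logistic q \<alpha> (y - 1) * (q + r / q))"
    unfolding 1 3 by simp
  also have "\<dots> = logistic_step q \<alpha> y * (q + r / q)"
    unfolding logistic_step_eq[OF assms(1,2)] by simp
  finally show ?thesis .
qed

definition logistic_product :: "real \<Rightarrow> real \<Rightarrow> nat \<Rightarrow> int \<Rightarrow> real" where
  "logistic_product q \<alpha> k y = (\<Prod>i<k. logistic q \<alpha> (y - int i))"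

text \<open>
  The constant produced by the telescoping sums over the positions of the \<open>k\<close> leftmost particles;
  it equals \<open>q^(k * (k - 1) / 2)\<close> divided by the q-factorial of \<open>k\<close>.
\<close>
definition normaliser :: "real \<Rightarrow> nat \<Rightarrow> real" where
  "normaliser q k = (\<Prod>i<k. q ^ i * (1 - q) / (1 - q ^ Suc i))"

text \<open>
  The summation step of the normalisation.  After the \<open>k\<close> leftmost positions have been summed, the next
  particle at \<open>y\<close> forces them to stay at or below \<open>y - 2\<close> in the coordinates \<open>y\<^sub>j = x\<^sub>j + j - d\<close>; the summand
  is then a difference of consecutive values of a single function.
\<close>
lemma logistic_product_diff:
  assumes "0 < q" "q < 1" "0 < \<alpha>"
  shows "normaliser q k * logistic_product q \<alpha> k (y - 2) * logistic_step q \<alpha> y =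
    normaliser q (Suc k) * (logistic_product q \<alpha> (Suc k) y - logistic_product q \<alpha> (Suc k) (y - 1))"
proof -
  let ?g = "logistic q \<alpha>" and ?P = "logistic_product q \<alpha>"
  have P1: "?P (Suc k) z = ?g z * ?P k (z - 1)" for z
    unfolding logistic_product_def prod.lessThan_Suc_shift by (simp add: algebra_simps comp_def)
  have P2: "?P (Suc k) z = ?P k z * ?g (z - int k)" for z
    by (simp add: logistic_product_def)
  have e: "?g (y - 1) * ?P k (y - 2) = ?P k (y - 1) * ?g (y - int (Suc k))"
    using P1[of "y - 1"] P2[of "y - 1"] by (simp add: algebra_simps)
  have qk: "q ^ Suc k < 1" using assms by (intro power_Suc_less_one) auto
  have N: "normaliser q (Suc k) * (1 - q ^ Suc k) = normaliser q k * (q ^ k * (1 - q))"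
    using qk by (simp add: normaliser_def)
  have pw: "q powr (real_of_int y - real (Suc k) - 1 / 2) * q ^ k = q powr (real_of_int y - 3 / 2)"
    using assms by (simp add: powr_realpow[symmetric] powr_add[symmetric])
  have "?P (Suc k) y - ?P (Suc k) (y - 1) = ?P k (y - 1) * (?g y - ?g (y - int (Suc k)))"
    using P1[of y] P2[of "y - 1"] by (simp add: algebra_simps)
  also have "\<dots> = \<alpha> * q powr (real_of_int y - real (Suc k) - 1 / 2) * (1 - q ^ Suc k) * ?g y * (?P k (y - 1) * ?g (y - int (Suc k)))"
    unfolding logistic_diff[OF assms(1,3)] by (simp only: mult_ac)
  finally have "normaliser q (Suc k) * (?P (Suc k) y - ?P (Suc k) (y - 1)) =
    (normaliser q (Suc k) * (1 - q ^ Suc k)) * \<alpha> * q powr (real_of_int y - real (Suc k) - 1 / 2) * ?g y * (?g (y - 1) * ?P k (y - 2))"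
    unfolding e by (simp only: mult_ac)
  also have "\<dots> = normaliser q k * ?P k (y - 2) * (\<alpha> * (q powr (real_of_int y - real (Suc k) - 1 / 2) * q ^ k) * (1 - q) * ?g y * ?g (y - 1))"
    unfolding N by (simp only: mult_ac)
  also have "\<dots> = normaliser q k * ?P k (y - 2) * logistic_step q \<alpha> y"
    unfolding pw logistic_step_eq[OF assms(1,3)] ..
  finally show ?thesis by simp
qed

lemma logistic_limits:
  assumes "0 < q" "q < 1" "0 < \<alpha>"
  shows "(\<lambda>n. logistic q \<alpha> (y - int n)) \<longlonglongrightarrow> 0" and "(\<lambda>n. logistic q \<alpha> (y + int n)) \<longlonglongrightarrow> 1"
proof -
  define a where "a = \<alpha> * q powr (real_of_int y - 1 / 2)"
  have a: "0 < a" using assms by (simp add: a_def)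
  have "q powr (real_of_int (y - int n) - 1 / 2) = q powr (real_of_int y - 1 / 2) / q ^ n" for n
    using assms by (simp add: powr_realpow[symmetric] powr_diff[symmetric] algebra_simps)
  then have "logistic q \<alpha> (y - int n) = 1 / (1 + a / q ^ n)" for n
    by (simp add: logistic_def a_def)
  then have "logistic q \<alpha> (y - int n) = q ^ n / (q ^ n + a)" for n
    using assms by (simp add: field_simps)
  moreover have "(\<lambda>n. q ^ n / (q ^ n + a)) \<longlonglongrightarrow> 0 / (0 + a)"
    using assms a by (intro tendsto_intros LIMSEQ_realpow_zero) auto
  ultimately show "(\<lambda>n. logistic q \<alpha> (y - int n)) \<longlonglongrightarrow> 0" by simp
  have "q powr (real_of_int (y + int n) - 1 / 2) = q powr (real_of_int y - 1 / 2) * q ^ n" for n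
    using assms by (simp add: powr_realpow[symmetric] powr_add[symmetric] algebra_simps)
  then have "logistic q \<alpha> (y + int n) = 1 / (1 + a * q ^ n)" for n
    by (simp add: logistic_def a_def)
  moreover have "(\<lambda>n. 1 / (1 + a * q ^ n)) \<longlonglongrightarrow> 1 / (1 + a * 0)"
    using assms by (intro tendsto_intros LIMSEQ_realpow_zero) auto
  ultimately show "(\<lambda>n. logistic q \<alpha> (y + int n)) \<longlonglongrightarrow> 1" by simp
qed

lemma logistic_product_limits:
  assumes "0 < q" "q < 1" "0 < \<alpha>"
  shows "(\<lambda>n. logistic_product q \<alpha> (Suc k) (y - int n)) \<longlonglongrightarrow> 0"
    and "(\<lambda>n. logistic_product q \<alpha> k (y + int n)) \<longlonglongrightarrow> 1"
proof -
  have down: "logistic_product q \<alpha> (Suc k) (y - int n) = (\<Prod>i<Suc k. logistic q \<alpha> ((y - int i) - int n))" for n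
    unfolding logistic_product_def by (intro prod.cong refl arg_cong[where f = "logistic q \<alpha>"]) simp
  have up: "logistic_product q \<alpha> k (y + int n) = (\<Prod>i<k. logistic q \<alpha> ((y - int i) + int n))" for n
    unfolding logistic_product_def by (intro prod.cong refl arg_cong[where f = "logistic q \<alpha>"]) simp
  have "(\<lambda>n. \<Prod>i<Suc k. logistic q \<alpha> ((y - int i) - int n)) \<longlonglongrightarrow> (\<Prod>i<Suc k. 0)"
    by (intro tendsto_prod logistic_limits assms)
  then show "(\<lambda>n. logistic_product q \<alpha> (Suc k) (y - int n)) \<longlonglongrightarrow> 0"
    unfolding down by simp
  have "(\<lambda>n. \<Prod>i<k. logistic q \<alpha> ((y - int i) + int n)) \<longlonglongrightarrow> (\<Prod>i<k. 1)"
    by (intro tendsto_prod logistic_limits assms)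
  then show "(\<lambda>n. logistic_product q \<alpha> k (y + int n)) \<longlonglongrightarrow> 1"
    unfolding up by simp
qed

section \<open>The law of the positions up to a constant\<close>

definition step_product :: "real \<Rightarrow> real \<Rightarrow> nat \<Rightarrow> (nat \<Rightarrow> int) \<Rightarrow> real" where
  "step_product q \<alpha> d x = (\<Prod>j=1..d. logistic_step q \<alpha> (x j + int j - int d))"

lemma step_product_pos: "0 < q \<Longrightarrow> q < 1 \<Longrightarrow> 0 < \<alpha> \<Longrightarrow> 0 < step_product q \<alpha> d x"
  unfolding step_product_def by (intro prod_pos) (simp add: logistic_step_pos)

lemma card_greater_strict_mono:
  fixes x :: "nat \<Rightarrow> int"
  assumes "strict_mono_on {1..d} x" "j \<in> {1..d}" "x j + 1 \<notin> x ` {1..d}"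
  shows "card {y \<in> x ` {1..d}. x j + 1 < y} = d - j"
proof -
  have "{y \<in> x ` {1..d}. x j + 1 < y} = x ` {j<..d}"
  proof (intro equalityI subsetI)
    fix y assume "y \<in> {y \<in> x ` {1..d}. x j + 1 < y}"
    then obtain k where k: "k \<in> {1..d}" "y = x k" "x j + 1 < x k" by auto
    have "\<not> k \<le> j"
    proof
      assume "k \<le> j"
      then have "x k \<le> x j"
        using assms(1,2) k(1) by (metis le_neq_implies_less order_le_less strict_mono_onD)
      with k show False by simp
    qed
    then show "y \<in> x ` {j<..d}" using k by auto
  next
    fix y assume "y \<in> x ` {j<..d}"
    then obtain k where k: "j < k" "k \<le> d" "y = x k" by auto
    then have "k \<in> {1..d}" by simp
    then have "x j < x k" using assms(1,2) k(1) by (meson strict_mono_onD)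
    moreover have "x k \<noteq> x j + 1" using assms(3) \<open>k \<in> {1..d}\<close> by (metis imageI)
    ultimately show "y \<in> {y \<in> x ` {1..d}. x j + 1 < y}" using k \<open>k \<in> {1..d}\<close> by auto
  qed
  moreover have "inj_on x {j<..d}"
    using strict_mono_on_imp_inj_on[OF assms(1)] by (rule inj_on_subset) auto
  ultimately show ?thesis by (simp add: card_image)
qed

text \<open>
  Moving the particles to the right one at a time, always the rightmost one that has not
  yet arrived, keeps them distinct, so that the jump relation applies to every move.
\<close>
lemma product_form_move:
  fixes f :: "int set \<Rightarrow> real" and x :: "nat \<Rightarrow> int"
  assumes q: "0 < q" "q < 1" "0 < \<alpha>"
    and step: "\<And>X i r. finite X \<Longrightarrow> card X = d \<Longrightarrow> i \<in> X \<Longrightarrow> i + 1 \<notin> X \<Longrightarrow>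
      r = \<alpha> * q powr (real_of_int i + 1 / 2 - real (card {x\<in>X. i + 1 < x})) \<Longrightarrow>
      f (insert (i + 1) (X - {i})) * (1 + r) = f X * (q + r / q)"
    and x: "strict_mono_on {1..d} x" "\<And>j. j \<in> {1..d} \<Longrightarrow> x j \<le> m + int j"
  shows "f (x ` {1..d}) * step_product q \<alpha> d (\<lambda>j. m + int j) =
    f ((\<lambda>j. m + int j) ` {1..d}) * step_product q \<alpha> d x"
  using x
proof (induction "\<Sum>j=1..d. nat (m + int j - x j)" arbitrary: x rule: less_induct)
  case less
  show ?case
  proof (cases "\<forall>j\<in>{1..d}. x j = m + int j")
    case True
    then have "x ` {1..d} = (\<lambda>j. m + int j) ` {1..d}" by (intro image_cong) auto
    moreover have "step_product q \<alpha> d x = step_product q \<alpha> d (\<lambda>j. m + int j)"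
      unfolding step_product_def using True by (intro prod.cong) auto
    ultimately show ?thesis by simp
  next
    case False
    \<comment> \<open>The rightmost particle that has not arrived; the particles beyond it form the packed block.\<close>
    define j where "j = Max {j \<in> {1..d}. x j \<noteq> m + int j}"
    have "j \<in> {j \<in> {1..d}. x j \<noteq> m + int j}"
      unfolding j_def using False by (intro Max_in) auto
    then have j: "j \<in> {1..d}" "x j < m + int j" using less.prems(2)[of j] by auto
    have above: "x k = m + int k" if "j < k" "k \<le> d" for k
    proof (rule ccontr)
      assume "x k \<noteq> m + int k"
      then have "k \<le> j" unfolding j_def using that by (intro Max_ge) auto
      with that show False by simp
    qed
    have below: "x k < x j" if "k < j" "k \<in> {1..d}" for k
      using less.prems(1) that j(1) by (meson strict_mono_onD)
    have free: "x j + 1 < x k" if "j < k" "k \<le> d" for k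
      using above[OF that] j(2) that by simp
    have notin: "x j + 1 \<notin> x ` {1..d}"
    proof
      assume "x j + 1 \<in> x ` {1..d}"
      then obtain k where "k \<in> {1..d}" "x k = x j + 1" by auto
      then show False using below[of k] free[of k] by (cases k j rule: linorder_cases) auto
    qed
    let ?x = "x(j := x j + 1)"
    have inj: "inj_on x {1..d}" using less.prems(1) by (rule strict_mono_on_imp_inj_on)
    have smx: "strict_mono_on {1..d} ?x"
    proof (rule strict_mono_onI)
      fix a b assume ab: "a \<in> {1..d}" "b \<in> {1..d}" "a < b"
      then have "x a < x b" using less.prems(1) by (meson strict_mono_onD)
      then show "?x a < ?x b" using ab free[of b] by auto
    qed
    have lex: "?x k \<le> m + int k" if "k \<in> {1..d}" for k
      using that less.prems(2)[of k] j(2) by auto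
    have dec: "(\<Sum>k=1..d. nat (m + int k - ?x k)) < (\<Sum>k=1..d. nat (m + int k - x k))"
      using j by (intro sum_strict_mono_ex1) auto
    have im: "?x ` {1..d} = insert (x j + 1) (x ` {1..d} - {x j})"
    proof -
      have "{1..d} = insert j ({1..d} - {j})" using j(1) by auto
      then have "?x ` {1..d} = insert (x j + 1) (x ` ({1..d} - {j}))"
        by (metis (no_types, lifting) fun_upd_image fun_upd_same image_insert insertI1)
      also have "x ` ({1..d} - {j}) = x ` {1..d} - {x j}"
        using inj j(1) by (subst inj_on_image_set_diff[of x "{1..d}"]) auto
      finally show ?thesis .
    qed
    define r where "r = \<alpha> * q powr (real_of_int (x j + int j - int d) + 1 / 2)"
    have r0: "0 < r" using q by (simp add: r_def)
    have card: "card (x ` {1..d}) = d" using inj by (simp add: card_image)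
    have r': "r = \<alpha> * q powr (real_of_int (x j) + 1 / 2 - real (card {y\<in>x ` {1..d}. x j + 1 < y}))"
      unfolding card_greater_strict_mono[OF less.prems(1) j(1) notin] r_def using j(1)
      by (simp add: of_nat_diff algebra_simps)
    have f: "f (?x ` {1..d}) * (1 + r) = f (x ` {1..d}) * (q + r / q)"
      unfolding im by (rule step[OF _ card _ notin r']) (use j(1) in auto)
    let ?y = "x j + int j - int d"
    let ?R = "\<Prod>k\<in>{1..d} - {j}. logistic_step q \<alpha> (x k + int k - int d)"
    have P: "step_product q \<alpha> d x = logistic_step q \<alpha> ?y * ?R"
      unfolding step_product_def using j(1) by (subst prod.remove[of _ j]) auto
    have P': "step_product q \<alpha> d ?x = logistic_step q \<alpha> (?y + 1) * ?R"
    proof -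
      have "step_product q \<alpha> d ?x = logistic_step q \<alpha> (?y + 1) *
        (\<Prod>k\<in>{1..d} - {j}. logistic_step q \<alpha> (?x k + int k - int d))"
        unfolding step_product_def using j(1) by (subst prod.remove[of _ j]) (auto simp: algebra_simps)
      also have "(\<Prod>k\<in>{1..d} - {j}. logistic_step q \<alpha> (?x k + int k - int d)) = ?R"
        by (intro prod.cong) auto
      finally show ?thesis .
    qed
    have s: "logistic_step q \<alpha> (?y + 1) * (1 + r) = logistic_step q \<alpha> ?y * (q + r / q)"
      by (rule logistic_step_ratio[OF q(1,3) r_def])
    have "f (?x ` {1..d}) * step_product q \<alpha> d x * (1 + r) * (q + r / q) =
      (f (?x ` {1..d}) * (1 + r)) * ((logistic_step q \<alpha> ?y * (q + r / q)) * ?R)"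
      unfolding P by (simp only: mult_ac)
    also have "\<dots> = f (x ` {1..d}) * step_product q \<alpha> d ?x * (1 + r) * (q + r / q)"
      unfolding f s[symmetric] P' by (simp only: mult_ac)
    finally have e: "f (?x ` {1..d}) * step_product q \<alpha> d x = f (x ` {1..d}) * step_product q \<alpha> d ?x"
    proof -
      assume a: "f (?x ` {1..d}) * step_product q \<alpha> d x * (1 + r) * (q + r / q) =
        f (x ` {1..d}) * step_product q \<alpha> d ?x * (1 + r) * (q + r / q)"
      have "1 + r > 0" "q + r / q > 0" using r0 q by (simp_all add: add_pos_pos)
      then show ?thesis using a by simp
    qed
    have IH: "f (?x ` {1..d}) * step_product q \<alpha> d (\<lambda>j. m + int j) =
      f ((\<lambda>j. m + int j) ` {1..d}) * step_product q \<alpha> d ?x"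
      using dec smx lex by (rule less.hyps)
    have "f (x ` {1..d}) * step_product q \<alpha> d (\<lambda>j. m + int j) * step_product q \<alpha> d ?x =
      f (?x ` {1..d}) * step_product q \<alpha> d (\<lambda>j. m + int j) * step_product q \<alpha> d x"
      using e by (simp add: mult_ac)
    also have "\<dots> = f ((\<lambda>j. m + int j) ` {1..d}) * step_product q \<alpha> d x * step_product q \<alpha> d ?x"
      unfolding IH by (simp only: mult_ac)
    finally show ?thesis using step_product_pos[OF q, of d ?x] by simp
  qed
qed

text \<open>
  Any two tuples can be moved to a common packed tuple far to the right, whence the ratio of \<open>f\<close> and the product
  is the same for both.
\<close>
lemma product_form:
  fixes f :: "int set \<Rightarrow> real"
  assumes q: "0 < q" "q < 1" "0 < \<alpha>"
    and step: "\<And>X i r. finite X \<Longrightarrow> card X = d \<Longrightarrow> i \<in> X \<Longrightarrow> i + 1 \<notin> X \<Longrightarrow>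
      r = \<alpha> * q powr (real_of_int i + 1 / 2 - real (card {x\<in>X. i + 1 < x})) \<Longrightarrow>
      f (insert (i + 1) (X - {i})) * (1 + r) = f X * (q + r / q)"
  obtains C where "\<And>x. strict_mono_on {1..d} x \<Longrightarrow> f (x ` {1..d}) = C * step_product q \<alpha> d x"
proof -
  let ?P = "step_product q \<alpha> d"
  have "f (x ` {1..d}) = f (int ` {1..d}) / ?P int * ?P x" if x: "strict_mono_on {1..d} x" for x
  proof -
    define m where "m = Max (insert 0 ((\<lambda>j. x j - int j) ` {1..d}))"
    have m: "x j \<le> m + int j" if "j \<in> {1..d}" for j
    proof -
      have "x j - int j \<le> m" unfolding m_def using that by (intro Max_ge) auto
      then show ?thesis by simp
    qed
    have m0: "0 \<le> m" unfolding m_def by (intro Max_ge) auto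
    let ?z = "\<lambda>j. m + int j"
    have 1: "f (x ` {1..d}) * ?P ?z = f (?z ` {1..d}) * ?P x"
      using q step x m by (rule product_form_move)
    have 2: "f (int ` {1..d}) * ?P ?z = f (?z ` {1..d}) * ?P int"
      using q step _ _ by (rule product_form_move) (use m0 in \<open>auto intro: strict_mono_onI\<close>)
    have pos: "0 < ?P ?z" "0 < ?P int" using step_product_pos[OF q] by auto
    have "f (x ` {1..d}) * ?P int * ?P ?z = f (int ` {1..d}) * ?P x * ?P ?z"
    proof -
      have "f (x ` {1..d}) * ?P int * ?P ?z = (f (x ` {1..d}) * ?P ?z) * ?P int" by simp
      also have "\<dots> = (f (int ` {1..d}) * ?P ?z) * ?P x" unfolding 1 2 by simp
      finally show ?thesis by simp
    qed
    then show ?thesis using pos by (simp add: field_simps)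
  qed
  then show ?thesis by (rule that)
qed

section \<open>Normalisation\<close>

definition ordered_nth :: "int set \<Rightarrow> nat \<Rightarrow> int" where
  "ordered_nth X j = sorted_list_of_set X ! (j - 1)"

lemma ordered_nth_less:
  assumes "finite X" "card X = d" "1 \<le> j" "j < k" "k \<le> d"
  shows "ordered_nth X j < ordered_nth X k"
  unfolding ordered_nth_def using assms
  by (intro sorted_wrt_nth_less[of "(<)"]) (auto simp: strict_sorted_list_of_set)

lemma image_ordered_nth:
  assumes "finite X" "card X = d"
  shows "ordered_nth X ` {1..d} = X"
proof -
  have "{1..d} = Suc ` {..<d}" by (auto simp: image_Suc_lessThan)
  then have "ordered_nth X ` {1..d} = (\<lambda>i. sorted_list_of_set X ! i) ` {..<d}"
    by (simp add: image_image ordered_nth_def)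
  also have "\<dots> = set (sorted_list_of_set X)"
    using assms by (auto simp: set_conv_nth simp del: set_sorted_list_of_set)
  finally show ?thesis using assms by simp
qed

lemma ordered_nth_image:
  assumes "strict_mono_on {1..d} x" "j \<in> {1..d}"
  shows "ordered_nth (x ` {1..d}) j = x j"
proof -
  define l where "l = map x [1..<Suc d]"
  have "sorted_wrt (<) l"
    unfolding l_def sorted_wrt_map
    by (rule sorted_wrt_mono_rel[OF _ sorted_wrt_upt])
      (use assms(1) in \<open>auto intro: strict_mono_onD\<close>)
  moreover have "set l = x ` {1..d}" 
    unfolding l_def set_map by (intro image_cong) auto
  ultimately have "sorted_list_of_set (x ` {1..d}) = l"
    by (intro strict_sorted_equal) (auto simp: strict_sorted_list_of_set)
  then have "ordered_nth (x ` {1..d}) j = map x [1..<Suc d] ! (j - 1)" by (simp add: ordered_nth_def l_def)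
  also have "\<dots> = x ([1..<Suc d] ! (j - 1))" using assms(2) by (intro nth_map) auto
  also have "[1..<Suc d] ! (j - 1) = j" using assms(2) by (subst nth_upt) auto
  finally show ?thesis .
qed

definition set_event :: "nat \<Rightarrow> (int set \<Rightarrow> bool) \<Rightarrow> (int \<Rightarrow> int) set" where
  "set_event d R = {\<sigma>. bij \<sigma> \<and> R {s. 0 < \<sigma> s \<and> \<sigma> s \<le> int d}}"

lemma set_event_sets: "set_event d R \<in> sets permutations_Z"
proof -
  have "set_event d R = (\<Union>X\<in>{X. finite X \<and> R X}. second_class_event d X)"
    using second_class_set_card(1)[of _ 0 d] by (auto simp: set_event_def second_class_event_def)
  also have "\<dots> \<in> sets permutations_Z"
    by (rule sets.countable_UN'[OF countable_subset[OF _ countable_Collect_finite]])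
      (auto simp: second_class_event_sets)
  finally show ?thesis .
qed

text \<open>
  The event summed over in the normalisation: the positions after the \<open>k\<close>-th are prescribed, and the
  \<open>k\<close>-th is bounded.  For \<open>k = 0\<close> there is no bound, as there is no position with index zero.
\<close>
definition tail_fixed :: "nat \<Rightarrow> nat \<Rightarrow> int \<Rightarrow> (nat \<Rightarrow> int) \<Rightarrow> int set \<Rightarrow> bool" where
  "tail_fixed d k z x X \<longleftrightarrow> (k = 0 \<or> ordered_nth X k \<le> z) \<and> (\<forall>j\<in>{Suc k..d}. ordered_nth X j = x j)"

text \<open>
  Splits according to the gap \<open>n\<close> between the bound and the position with index \<open>k + 1\<close>; the next
  particle to the left is then at least one site further left.
\<close>
lemma tail_fixed_Suc:
  assumes "finite X" "card X = d" "Suc k \<le> d"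
  shows "tail_fixed d (Suc k) z x X \<longleftrightarrow>
    (\<exists>n. tail_fixed d k (z - int n - 1) (x(Suc k := z - int n)) X)"
proof
  assume t: "tail_fixed d (Suc k) z x X"
  define n where "n = nat (z - ordered_nth X (Suc k))"
  have n: "ordered_nth X (Suc k) = z - int n" using t by (simp add: n_def tail_fixed_def)
  have "ordered_nth X k \<le> z - int n - 1" if "k \<noteq> 0"
    using ordered_nth_less[OF assms(1,2), of k "Suc k"] that assms(3) n by simp
  moreover have "ordered_nth X j = (x(Suc k := z - int n)) j" if "j \<in> {Suc k..d}" for j
    using that t n by (cases "j = Suc k") (auto simp: tail_fixed_def)
  ultimately show "\<exists>n. tail_fixed d k (z - int n - 1) (x(Suc k := z - int n)) X"
    by (auto simp: tail_fixed_def)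
next
  assume "\<exists>n. tail_fixed d k (z - int n - 1) (x(Suc k := z - int n)) X"
  then obtain n where "\<And>j. j \<in> {Suc k..d} \<Longrightarrow> ordered_nth X j = (x(Suc k := z - int n)) j"
    by (auto simp: tail_fixed_def)
  from this[of "Suc k"] this show "tail_fixed d (Suc k) z x X"
    using assms(3) by (auto simp: tail_fixed_def)
qed

lemma set_event_tail_0:
  assumes "strict_mono_on {1..d} x"
  shows "set_event d (tail_fixed d 0 z x) = second_class_event d (x ` {1..d})"
proof -
  have "tail_fixed d 0 z x X \<longleftrightarrow> X = x ` {1..d}" if "finite X" "card X = d" for X
  proof
    assume "tail_fixed d 0 z x X"
    then have "ordered_nth X ` {1..d} = x ` {1..d}" by (intro image_cong) (auto simp: tail_fixed_def)
    then show "X = x ` {1..d}" using image_ordered_nth[OF that] by simp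
  qed (use ordered_nth_image[OF assms] in \<open>auto simp: tail_fixed_def\<close>)
  moreover have "finite {s. 0 < \<sigma> s \<and> \<sigma> s \<le> int d}" "card {s. 0 < \<sigma> s \<and> \<sigma> s \<le> int d} = d" if "bij \<sigma>" for \<sigma>
    using second_class_set_card[OF that, of 0 d] by simp_all
  ultimately show ?thesis
    unfolding set_event_def second_class_event_def by (intro Collect_cong conj_cong refl) blast
qed

text \<open>
  Induction on the number \<open>k\<close> of positions that have been summed out; the sum over the position with
  index \<open>k + 1\<close> telescopes.
\<close>
lemma tail_law:
  assumes N: "finite_measure N" "sets N = sets permutations_Z"
    and q: "0 < q" "q < 1" "0 < \<alpha>"
    and C: "\<And>x. strict_mono_on {1..d} x \<Longrightarrow>
      measure N (second_class_event d (x ` {1..d})) = C * step_product q \<alpha> d x"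
    and "k \<le> d" "strict_mono_on {Suc k..d} x" "k < d \<Longrightarrow> z < x (Suc k)"
  shows "measure N (set_event d (tail_fixed d k z x)) =
    C * normaliser q k * logistic_product q \<alpha> k (z + int k - int d) *
    (\<Prod>j=Suc k..d. logistic_step q \<alpha> (x j + int j - int d))"
  using assms(7-9)
proof (induction k arbitrary: z x)
  case 0
  then show ?case
    using C[of x] by (simp add: set_event_tail_0 normaliser_def logistic_product_def step_product_def)
next
  case (Suc k)
  interpret finite_measure N by fact
  let ?x = "\<lambda>n. x(Suc k := z - int n)"
  let ?E = "\<lambda>n. set_event d (tail_fixed d k (z - int n - 1) (?x n))"
  let ?R = "\<Prod>j=Suc (Suc k)..d. logistic_step q \<alpha> (x j + int j - int d)"
  let ?Y = "z + int (Suc k) - int d"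
  let ?L = "\<lambda>n. logistic_product q \<alpha> (Suc k) (?Y - int n)"
  have E: "set_event d (tail_fixed d (Suc k) z x) = (\<Union>n. ?E n)"
    using tail_fixed_Suc[OF second_class_set_card[of _ 0 d] Suc.prems(1)] by (auto simp: set_event_def)
  have disj: "disjoint_family ?E"
  proof -
    have pos: "z - int n = ordered_nth {s. 0 < \<sigma> s \<and> \<sigma> s \<le> int d} (Suc k)" if "\<sigma> \<in> ?E n" for n \<sigma>
      using that Suc.prems(1) by (auto simp: set_event_def tail_fixed_def)
    have "m = n" if "\<sigma> \<in> ?E m" "\<sigma> \<in> ?E n" for m n \<sigma>
      using pos[OF that(1)] pos[OF that(2)] by simp
    then show ?thesis unfolding disjoint_family_on_def by blast
  qed
  have summand: "measure N (?E n) = C * normaliser q (Suc k) * ?R * (?L n - ?L (Suc n))" for n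
  proof -
    let ?y = "?Y - int n"
    have mono: "strict_mono_on {Suc k..d} (?x n)"
    proof (rule strict_mono_onI)
      fix a b assume ab: "a \<in> {Suc k..d}" "b \<in> {Suc k..d}" "a < b"
      show "?x n a < ?x n b"
      proof (cases "a = Suc k")
        case True
        then have "Suc k < d" using ab by auto
        then have "z < x (Suc (Suc k))" by (rule Suc.prems(3))
        also have "x (Suc (Suc k)) \<le> x b"
          using Suc.prems(2) ab True by (cases "b = Suc (Suc k)") (auto dest: strict_mono_onD[of _ _ "Suc (Suc k)" b])
        finally show ?thesis using True ab by simp
      next
        case False
        then show ?thesis using Suc.prems(2) ab by (auto dest: strict_mono_onD[of _ _ a b])
      qed
    qed
    have "measure N (?E n) = C * normaliser q k * logistic_product q \<alpha> k (z - int n - 1 + int k - int d) *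
      (\<Prod>j=Suc k..d. logistic_step q \<alpha> (?x n j + int j - int d))"
    proof (rule Suc.IH)
      show "k \<le> d" using Suc.prems(1) by simp
      show "strict_mono_on {Suc k..d} (?x n)" by (rule mono)
    qed simp
    also have "(\<Prod>j=Suc k..d. logistic_step q \<alpha> (?x n j + int j - int d)) = logistic_step q \<alpha> ?y * ?R"
      using Suc.prems(1) by (subst prod.atLeast_Suc_atMost) (auto simp: algebra_simps intro!: prod.cong)
    also have "z - int n - 1 + int k - int d = ?y - 2" by simp
    also have "C * normaliser q k * logistic_product q \<alpha> k (?y - 2) * (logistic_step q \<alpha> ?y * ?R) =
      C * ?R * (normaliser q k * logistic_product q \<alpha> k (?y - 2) * logistic_step q \<alpha> ?y)"
      by (simp only: mult_ac)
    also have "\<dots> = C * ?R * (normaliser q (Suc k) * (?L n - ?L (Suc n)))"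
      unfolding logistic_product_diff[OF q] by (simp add: algebra_simps)
    finally show ?thesis by (simp only: mult_ac)
  qed
  have telescope: "(\<lambda>n. C * normaliser q (Suc k) * ?R * (?L n - ?L (Suc n))) sums
    (C * normaliser q (Suc k) * ?R * (?L 0 - 0))"
    by (intro sums_mult telescope_sums' logistic_product_limits q)
  have "(\<lambda>n. measure N (?E n)) sums measure N (\<Union>n. ?E n)"
    using disj N(2) set_event_sets by (intro finite_measure_UNION) auto
  then have "measure N (\<Union>n. ?E n) = C * normaliser q (Suc k) * ?R * (?L 0 - 0)"
    unfolding summand by (rule sums_unique2[OF _ telescope])
  then show ?case unfolding E by (simp add: mult_ac)
qed

text \<open>
  For \<open>k = d\<close> only the bound on the rightmost position remains; it becomes certain as the bound grows.
\<close>
lemma normalisation: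
  assumes N: "prob_space N" "sets N = sets permutations_Z"
    and q: "0 < q" "q < 1" "0 < \<alpha>" and d: "1 \<le> d"
    and C: "\<And>x. strict_mono_on {1..d} x \<Longrightarrow>
      measure N (second_class_event d (x ` {1..d})) = C * step_product q \<alpha> d x"
  shows "C * normaliser q d = 1"
proof -
  interpret prob_space N by fact
  let ?E = "\<lambda>n. set_event d (tail_fixed d d (int n) (\<lambda>_. 0))"
  have "(\<lambda>n. measure N (?E n)) \<longlonglongrightarrow> measure N (\<Union>n. ?E n)"
  proof (rule finite_Lim_measure_incseq)
    show "range ?E \<subseteq> events" unfolding N(2) using set_event_sets by blast
    show "incseq ?E" by (auto simp: incseq_def set_event_def tail_fixed_def)
  qed
  moreover have "(\<Union>n. ?E n) = space N"
  proof -
    have "\<exists>n. tail_fixed d d (int n) (\<lambda>_. 0) X" for X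
      by (rule exI[of _ "nat (ordered_nth X d)"]) (simp add: tail_fixed_def)
    then show ?thesis using sets_eq_imp_space_eq[OF N(2)] by (auto simp: set_event_def)
  qed
  moreover have "measure N (?E n) = C * normaliser q d * logistic_product q \<alpha> d (0 + int n)" for n
    using tail_law[OF finite_measure_axioms N(2) q C, of d "\<lambda>_. 0" "int n"]
    by (simp add: strict_mono_on_def)
  ultimately have "(\<lambda>n. C * normaliser q d * logistic_product q \<alpha> d (0 + int n)) \<longlonglongrightarrow> 1"
    by (simp add: prob_space)
  moreover have "(\<lambda>n. C * normaliser q d * logistic_product q \<alpha> d (0 + int n)) \<longlonglongrightarrow> C * normaliser q d * 1"
    by (intro tendsto_mult_left logistic_product_limits q)
  ultimately show ?thesis using LIMSEQ_unique by fastforce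
qed

lemma step_product_over_normaliser:
  assumes q: "0 < q" "q < 1" "0 < \<alpha>"
  shows "step_product q \<alpha> d x / normaliser q d =
    \<alpha> ^ d * q powr (real_of_int (\<Sum>i=1..d. x i) - real (d * (2 * d + 1)) / 2) *
      (\<Prod>i=1..d. 1 - q ^ i) /
    (\<Prod>j=1..d. (1 + \<alpha> * q powr (real_of_int (x j) + real j - real d - 3 / 2)) *
                (1 + \<alpha> * q powr (real_of_int (x j) + real j - real d - 1 / 2)))"
proof -
  let ?e = "\<lambda>j. real_of_int (x j) + real j - real d - 3 / 2"
  let ?D = "\<Prod>j=1..d. (1 + \<alpha> * q powr ?e j) * (1 + \<alpha> * q powr (real_of_int (x j) + real j - real d - 1 / 2))"
  have "step_product q \<alpha> d x = (\<Prod>j=1..d. \<alpha> * (1 - q) * q powr ?e j /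
    ((1 + \<alpha> * q powr ?e j) * (1 + \<alpha> * q powr (real_of_int (x j) + real j - real d - 1 / 2))))"
    unfolding step_product_def
  proof (intro prod.cong refl)
    fix j
    let ?y = "x j + int j - int d"
    have e: "real_of_int ?y - 3 / 2 = ?e j" "real_of_int (?y - 1) - 1 / 2 = ?e j"
      "real_of_int ?y - 1 / 2 = real_of_int (x j) + real j - real d - 1 / 2" by simp_all
    show "logistic_step q \<alpha> ?y = \<alpha> * (1 - q) * q powr ?e j /
      ((1 + \<alpha> * q powr ?e j) * (1 + \<alpha> * q powr (real_of_int (x j) + real j - real d - 1 / 2)))"
      unfolding logistic_step_eq[OF q(1,3)] logistic_def e by (simp only: times_divide_eq_left times_divide_eq_right divide_divide_eq_left mult_1_right mult_ac)
  qed
  also have "\<dots> = \<alpha> ^ d * (1 - q) ^ d * q powr (\<Sum>j=1..d. ?e j) / ?D"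
    using q by (simp add: prod_dividef prod.distrib powr_sum power_mult_distrib)
  finally have S: "step_product q \<alpha> d x = \<alpha> ^ d * (1 - q) ^ d * q powr (\<Sum>j=1..d. ?e j) / ?D" .
  have "normaliser q d = (\<Prod>i<d. q ^ i) * (1 - q) ^ d / (\<Prod>i<d. 1 - q ^ Suc i)"
    by (simp add: normaliser_def prod_dividef prod.distrib)
  also have "(\<Prod>i<d. 1 - q ^ Suc i) = (\<Prod>i=1..d. 1 - q ^ i)"
    by (rule prod.reindex_bij_witness[of _ "\<lambda>i. i - 1" Suc]) auto
  also have "(\<Prod>i<d. q ^ i) = q powr (\<Sum>i<d. real i)"
    using q by (simp add: powr_sum powr_realpow)
  finally have M: "normaliser q d = q powr (\<Sum>i<d. real i) * (1 - q) ^ d / (\<Prod>i=1..d. 1 - q ^ i)" .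
  have "(\<Sum>j=1..d. ?e j) - (\<Sum>i<d. real i) = real_of_int (\<Sum>i=1..d. x i) - real (d * (2 * d + 1)) / 2"
  proof -
    have "(\<Sum>j=1..d. real j) = (\<Sum>i<d. real i) + real d"
      by (induction d) auto
    moreover have "(\<Sum>j=1..d. ?e j) = real_of_int (\<Sum>i=1..d. x i) + (\<Sum>j=1..d. real j) - real d * real d - real d * (3 / 2)"
      by (simp add: sum.distrib sum_subtractf)
    ultimately show ?thesis by (simp add: field_simps)
  qed
  then have e: "q powr (\<Sum>j=1..d. ?e j) / q powr (\<Sum>i<d. real i) =
    q powr (real_of_int (\<Sum>i=1..d. x i) - real (d * (2 * d + 1)) / 2)"
    by (simp add: powr_diff[symmetric])
  have "step_product q \<alpha> d x / normaliser q d =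
    \<alpha> ^ d * (q powr (\<Sum>j=1..d. ?e j) / q powr (\<Sum>i<d. real i)) * (\<Prod>i=1..d. 1 - q ^ i) / ?D"
    unfolding S M using q by (simp add: field_simps)
  then show ?thesis unfolding e .
qed

theorem theorem5p1:
  fixes q \<alpha> :: real and d :: nat and x :: "nat \<Rightarrow> int"
    and M\<^sub>0 :: "(int \<Rightarrow> int) measure"
    and P :: "'a measure" and \<omega> :: "'a \<Rightarrow> int \<Rightarrow> int"
  assumes "0 < q" "q < 1" "0 < \<alpha>" "1 \<le> d"
    and "is_mallows_measure q M\<^sub>0"
    and "prob_space P" "\<omega> \<in> measurable P permutations_Z"
    and "distr P permutations_Z \<omega> = mallows_product_measure q \<alpha> M\<^sub>0"
    and "strict_mono_on {1..d} x"
  shows "measure P {p \<in> space P. \<forall>i\<in>{1..d}. second_class_position d (\<omega> p) i = x i} =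
    \<alpha> ^ d * q powr (real_of_int (\<Sum>i=1..d. x i) - real (d * (2 * d + 1)) / 2) *
      (\<Prod>i=1..d. 1 - q ^ i) /
    (\<Prod>j=1..d. (1 + \<alpha> * q powr (real_of_int (x j) + real j - real d - 3 / 2)) *
                (1 + \<alpha> * q powr (real_of_int (x j) + real j - real d - 1 / 2)))"
proof -
  note q = assms(1-3) and M = assms(5)
  define N where "N = distr P permutations_Z \<omega>"
  have Nm: "N = mallows_product_measure q \<alpha> M\<^sub>0" using assms(8) by (simp add: N_def)
  have sN: "sets N = sets permutations_Z" by (simp add: N_def)
  have N: "prob_space N" unfolding N_def using assms(6,7) by (rule prob_space.prob_space_distr)
  obtain K where K: "0 \<le> K" "\<And>A X. config A X \<Longrightarrow> card X = d \<Longrightarrow>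
       emeasure N (class_event 0 d A X) = ennreal (K * \<alpha> powi charge A * q powr energy A X)"
    using product_measure_gibbs[OF M q(1,3)] Nm by metis
  have gibbs: "emeasure N (class_event 0 d A X) = ennreal (K * config_weight q \<alpha> A X)"
    if "config A X" "card X = d" for A X
    using K(2)[OF that] by (simp add: config_weight_def mult.assoc)
  have null: "emeasure N {\<sigma>. bij \<sigma> \<and> \<not> sea {s. \<sigma> s \<le> 0}} = 0"
    "{\<sigma>. bij \<sigma> \<and> \<not> sea {s. \<sigma> s \<le> 0}} \<in> sets permutations_Z"
    using product_measure_nonsea_null[OF M] by (simp_all add: Nm)
  obtain C where C: "\<And>x. strict_mono_on {1..d} x \<Longrightarrow>
      measure N (second_class_event d (x ` {1..d})) = C * step_product q \<alpha> d x"
  proof (rule product_form[OF q, of d "\<lambda>X. measure N (second_class_event d X)"])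
    show "measure N (second_class_event d (insert (i + 1) (X - {i}))) * (1 + r) =
      measure N (second_class_event d X) * (q + r / q)"
      if "finite X" "card X = d" "i \<in> X" "i + 1 \<notin> X"
        "r = \<alpha> * q powr (real_of_int i + 1 / 2 - real (card {x\<in>X. i + 1 < x}))" for X i r
      using N sN null gibbs K(1) q that
      by (intro second_class_event_step) (auto simp: prob_space.finite_measure)
  qed blast
  have norm: "C * normaliser q d = 1" using normalisation[OF N sN q assms(4) C] .
  have "measure P {p \<in> space P. \<forall>i\<in>{1..d}. second_class_position d (\<omega> p) i = x i} =
    measure N (set_event d (tail_fixed d 0 0 x))"
  proof -
    have "{p \<in> space P. \<forall>i\<in>{1..d}. second_class_position d (\<omega> p) i = x i} =
      \<omega> -` set_event d (tail_fixed d 0 0 x) \<inter> space P"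
    proof -
      have "bij (\<omega> p)" if "p \<in> space P" for p using measurable_space[OF assms(7) that] by simp
      moreover have "second_class_position d \<sigma> i = ordered_nth {s. 0 < \<sigma> s \<and> \<sigma> s \<le> int d} i" for \<sigma> i
      proof -
        have "{s. \<sigma> s \<in> {1..int d}} = {s. 0 < \<sigma> s \<and> \<sigma> s \<le> int d}" by auto
        then show ?thesis by (simp add: second_class_position_def ordered_nth_def)
      qed
      ultimately show ?thesis by (auto simp: set_event_def tail_fixed_def)
    qed
    then show ?thesis
      unfolding N_def by (simp add: measure_distr[OF assms(7) set_event_sets])
  qed
  also have "\<dots> = C * step_product q \<alpha> d x"
    unfolding set_event_tail_0[OF assms(9)] by (rule C[OF assms(9)])
  also have "\<dots> = step_product q \<alpha> d x / normaliser q d"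
  proof -
    have "normaliser q d \<noteq> 0" using norm by auto
    then have "C = 1 / normaliser q d" using norm by (simp add: eq_divide_eq)
    then show ?thesis by simp
  qed
  finally show ?thesis unfolding step_product_over_normaliser[OF q] .
qed

end
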